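(* The conjugate prior distribution induced from $\pi_{\mathcal D}(\theta_{\mathcal D}\mid s,\alpha)$ by the change of variable $\theta_{\mathcal D}\mapsto p_{\mathcal D}$ is $$\pi^p_{\mathcal D}(p_{\mathcal D}\mid (s,\alpha))=\frac{K(p_{\mathcal D})^{-1}}{I_{\mathcal D}(s,\alpha)}\ \prod_{D\in\mathcal D}\prod_{i_D\in\mathcal I_D^*}p(i(D))^{\alpha(i(D))-1}\;p_\varnothing^{\alpha_\varnothing-1},$$ where $$\alpha(i(D))=\sum_{F\supseteq D,\,F\in\mathcal D}\ \sum_{\substack{j_F\in\mathcal I_F^*\\ (j_F)_D=i_D}}(-1)^{|F\setminus D|}s(j_F),\qquad \alpha_\varnothing=\alpha+\sum_{D\in\mathcal D}\sum_{i_D\in\mathcal I_D^*}(-1)^{|D|}s(i_D),$$ and where $$K(p_{\mathcal D})=\frac{J(p_{\mathcal D})}{p_\varnothing\prod_{D\in\mathcal D}\prod_{i_D\in\mathcal I_D^*}p(i(D))},$$ with $J(p_{\mathcal D})$ the Jacobian $\left|\frac{dp_{\mathcal D}}{d\theta_{\mathcal D}}\right|$, given for general hierarchical models by $$J(p_{\mathcal D})=\prod_{D\in\mathcal D,\ i_D\in\mathcal I_D^*}p(i(D))\Big(1-\sum_{H\subseteq V,\,H\neq\varnothing}\ \sum_{l_H\in\mathcal I_H^*}p(l(H))\sum_{F\in\mathcal D,\,F\subseteq H}(-1)^{|F|-1}\Big),$$ and for graphical models by $$J(p_{\mathcal D})=\prod_{D\in\mathcal D,\ i_D\in\mathcal I_D^*}p(i(D))\Big(p_\varnothing-\sum_{H\in\mathcal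 U_\ominus}\ \sum_{i_H\in\mathcal I_H^*}p(i(H))\,a(H)\Big).$$
   Context: $V$ is a finite nonempty set; for each $\gamma\in V$, $\mathcal I_\gamma$ is a finite set of levels with at least two elements, one of which is denoted $0$. $\mathcal I=\prod_{\gamma\in V}\mathcal I_\gamma$, $i^*=(0,\dots,0)$, $\mathcal I_E=\prod_{\gamma\in E}\mathcal I_\gamma$, and $\mathcal I_E^*=\{i_E\in\mathcal I_E:\ i_\gamma\neq 0\ \forall\gamma\in E\}$ (one element if $E=\varnothing$). For $F\subseteq E$ and $i_E\in\mathcal I_E$, $i_F=(i_E)_F$ is the subvector indexed by $F$. For $i_E\in\mathcal I^*_E$, $i(E)=(i_E,i^*_{E^c})\in\mathcal I$ is the cell equal to $i_E$ on $E$ and $0$ elsewhere. A hierarchical log-linear model is given by a generating class $\{A_1,\dots,A_k\}$ of subsets of $V$, and $\mathcal D=\{E\neq\varnothing:\ E\subseteq A_l\text{ for some }l\}$. The model is graphical with respect to an undirected graph $G$ with vertex set $V$ when the generating class is the set of cliques (maximal complete subsets) of $G$, i.e. $\mathcal D$ is the set of nonempty complete subsets of $G$. In that case $\mathcal U_\ominus$ is the set of nonempty $H\subseteq V$ whose induced subgraph in $G$ is either nondecomposable (i.e. not chordal) or not connected, and $a(H)=\sum_{C\in\mathcal D,\,C\subseteq H}(-1)^{|C|-1}-1$. Put $d_{\mathcal D}=\sum_{D\in\mathcal D}|\mathcal I_D^*|$. For $\theta_{\mathcal D}=(\theta(i_D),D\in\mathcal D,i_D\in\mathcal I_D^* )\in\mathbb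 R^{d_{\mathcal D}}$ let $$Z(\theta_{\mathcal D})=1+\sum_{E\subseteq V,\,E\ne\varnothing}\sum_{i_E\in\mathcal I_E^*}\exp\sum_{F\in\mathcal D,F\subseteq E}\theta(i_F),\qquad p(i(E))=Z(\theta_{\mathcal D})^{-1}\exp\sum_{F\in\mathcal D,F\subseteq E}\theta(i_F)\quad (E\subseteq V,\ i_E\in\mathcal I_E^* ),$$ $p_\varnothing=p(i^* )=Z(\theta_{\mathcal D})^{-1}$, and $p_{\mathcal D}=(p(i(D)),\,D\in\mathcal D,\,i_D\in\mathcal I_D^* )$, the cell probability parameter of the model; all other cell probabilities, including $p_\varnothing$, are regarded as expressed in terms of $p_{\mathcal D}$. The conjugate prior with hyperparameters $s=(s(i_D),D\in\mathcal D,i_D\in\mathcal I_D^* )\in\mathbb R^{d_{\mathcal D}}$, $\alpha\in\mathbb R$ has density with respect to Lebesgue measure $$\pi_{\mathcal D}(\theta_{\mathcal D}\mid s,\alpha)=I_{\mathcal D}(s,\alpha)^{-1}\exp\Big\{\sum_{D\in\mathcal D}\sum_{i_D\in\mathcal I_D^*}\theta(i_D)s(i_D)-\alpha\log Z(\theta_{\mathcal D})\Big\},$$ where $I_{\mathcal D}(s,\alpha)$ is the corresponding normalising constant, i.e. the integral of the exponential factor over $\mathbb R^{d_{\mathcal D}}$, and $(s,\alpha)$ is such that it is finite (the prior is proper).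
   Formalization: As θ_D↦p_D need not be injective, the density formula is stated on Borel regions where it is, with p_∅ and other cells given by the inverse there; in general the density sums the formula over all preimages. The J formulas give the signed determinant; K uses its absolute value. *)

theory Defs
  imports "HOL-Probability.Probability" "HOL-Combinatorics.Permutations"
begin

text \<open>
  The vertex set is the universe of a finite type. The levels of the vertex \<open>v\<close> form a
  subset \<open>I v\<close> of a finite type, and \<open>0\<close> is the distinguished level. A marginal cell \<open>i\<^sub>E\<close>
  is an extensional function on \<open>E\<close>, so that \<open>(i\<^sub>E)\<^sub>F\<close> is \<open>restrict i F\<close>.
\<close>

definition star_cells :: "('v \<Rightarrow> 'l::zero set) \<Rightarrow> 'v set \<Rightarrow> ('v \<Rightarrow> 'l) set"
  where "star_cells I E = (\<Pi>\<^sub>E v\<in>E. I v - {0})"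

definition interaction_sets :: "'v set set \<Rightarrow> 'v set set"
  where "interaction_sets A = {E. E \<noteq> {} \<and> (\<exists>B\<in>A. E \<subseteq> B)}"

text \<open>
  A coordinate \<open>\<theta>(i\<^sub>D)\<close> is indexed by the pair \<open>(D, i\<^sub>D)\<close>: an extensional function alone need not
  determine \<open>D\<close>, since \<open>undefined\<close> may be a level. Parameter vectors are the extensional
  functions on these pairs, and \<open>param_space\<close> carries the Lebesgue measure on them.
\<close>

type_synonym ('v, 'l) param = "'v set \<times> ('v \<Rightarrow> 'l)"

definition params :: "('v \<Rightarrow> 'l::zero set) \<Rightarrow> 'v set set \<Rightarrow> ('v, 'l) param set"
  where "params I \<D> = (SIGMA D:\<D>. star_cells I D)"

definition param_space ::
    "('v \<Rightarrow> 'l::zero set) \<Rightarrow> 'v set set \<Rightarrow> (('v, 'l) param \<Rightarrow> real) measure"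
  where "param_space I \<D> = (\<Pi>\<^sub>M d\<in>params I \<D>. lborel)"


section \<open>Cell probabilities\<close>

definition log_odds ::
    "'v set set \<Rightarrow> (('v, 'l) param \<Rightarrow> real) \<Rightarrow> 'v set \<Rightarrow> ('v \<Rightarrow> 'l) \<Rightarrow> real"
  where "log_odds \<D> \<theta> E i = (\<Sum>F\<in>{F\<in>\<D>. F \<subseteq> E}. \<theta> (F, restrict i F))"

definition Zfun ::
    "('v::finite \<Rightarrow> 'l::zero set) \<Rightarrow> 'v set set \<Rightarrow> (('v, 'l) param \<Rightarrow> real) \<Rightarrow> real"
  where "Zfun I \<D> \<theta> = 1 + (\<Sum>E\<in>{E. E \<noteq> {}}. \<Sum>i\<in>star_cells I E. exp (log_odds \<D> \<theta> E i))"

text \<open>\<open>cell_prob I \<D> \<theta> E i\<close> is \<open>p(i(E))\<close>, the probability of the cell that agrees with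
  \<open>i\<close> on \<open>E\<close> and is \<open>0\<close> elsewhere.\<close>

definition cell_prob ::
    "('v::finite \<Rightarrow> 'l::zero set) \<Rightarrow> 'v set set \<Rightarrow> (('v, 'l) param \<Rightarrow> real) \<Rightarrow>
      'v set \<Rightarrow> ('v \<Rightarrow> 'l) \<Rightarrow> real"
  where "cell_prob I \<D> \<theta> E i = inverse (Zfun I \<D> \<theta>) * exp (log_odds \<D> \<theta> E i)"

definition prob_empty ::
    "('v::finite \<Rightarrow> 'l::zero set) \<Rightarrow> 'v set set \<Rightarrow> (('v, 'l) param \<Rightarrow> real) \<Rightarrow> real"
  where "prob_empty I \<D> \<theta> = inverse (Zfun I \<D> \<theta>)"

definition prob_param ::
    "('v::finite \<Rightarrow> 'l::zero set) \<Rightarrow> 'v set set \<Rightarrow> (('v, 'l) param \<Rightarrow> real) \<Rightarrow>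
      (('v, 'l) param \<Rightarrow> real)"
  where "prob_param I \<D> \<theta> = (\<lambda>(D, i)\<in>params I \<D>. cell_prob I \<D> \<theta> D i)"


section \<open>The Jacobian\<close>

text \<open>The Leibniz formula, as for \<open>det\<close> in \<^theory>\<open>HOL-Analysis.Determinants\<close>, for
  a square matrix indexed by a finite set instead of a finite type.\<close>

definition det_on :: "'a set \<Rightarrow> ('a \<Rightarrow> 'a \<Rightarrow> real) \<Rightarrow> real"
  where "det_on S M = (\<Sum>\<pi>\<in>{\<pi>. \<pi> permutes S}. of_int (sign \<pi>) * (\<Prod>c\<in>S. M c (\<pi> c)))"

text \<open>The signed determinant of the matrix of the partial derivatives of \<open>p\<^sub>\<D>\<close>
  with respect to the coordinates of \<open>\<theta>\<^sub>\<D>\<close>; it can be negative.\<close>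

definition jacobian ::
    "('v::finite \<Rightarrow> 'l::zero set) \<Rightarrow> 'v set set \<Rightarrow> (('v, 'l) param \<Rightarrow> real) \<Rightarrow> real"
  where "jacobian I \<D> \<theta> =
    det_on (params I \<D>) (\<lambda>c d. deriv (\<lambda>t. prob_param I \<D> (\<theta>(d := t)) c) (\<theta> d))"

definition Kfun ::
    "('v::finite \<Rightarrow> 'l::zero set) \<Rightarrow> 'v set set \<Rightarrow> (('v, 'l) param \<Rightarrow> real) \<Rightarrow> real"
  where "Kfun I \<D> \<theta> = \<bar>jacobian I \<D> \<theta>\<bar> /
    (prob_empty I \<D> \<theta> * (\<Prod>D\<in>\<D>. \<Prod>i\<in>star_cells I D. cell_prob I \<D> \<theta> D i))"


section \<open>The conjugate prior\<close>

definition prior_kernel ::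
    "('v::finite \<Rightarrow> 'l::zero set) \<Rightarrow> 'v set set \<Rightarrow> (('v, 'l) param \<Rightarrow> real) \<Rightarrow> real \<Rightarrow>
      (('v, 'l) param \<Rightarrow> real) \<Rightarrow> real"
  where "prior_kernel I \<D> s \<alpha> \<theta> =
    exp ((\<Sum>D\<in>\<D>. \<Sum>i\<in>star_cells I D. \<theta> (D, i) * s (D, i)) - \<alpha> * ln (Zfun I \<D> \<theta>))"

definition proper_prior ::
    "('v::finite \<Rightarrow> 'l::zero set) \<Rightarrow> 'v set set \<Rightarrow> (('v, 'l) param \<Rightarrow> real) \<Rightarrow> real \<Rightarrow> bool"
  where "proper_prior I \<D> s \<alpha> \<longleftrightarrow> integrable (param_space I \<D>) (prior_kernel I \<D> s \<alpha>)"

definition prior_const ::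
    "('v::finite \<Rightarrow> 'l::zero set) \<Rightarrow> 'v set set \<Rightarrow> (('v, 'l) param \<Rightarrow> real) \<Rightarrow> real \<Rightarrow> real"
  where "prior_const I \<D> s \<alpha> = integral\<^sup>L (param_space I \<D>) (prior_kernel I \<D> s \<alpha>)"

definition prior_density ::
    "('v::finite \<Rightarrow> 'l::zero set) \<Rightarrow> 'v set set \<Rightarrow> (('v, 'l) param \<Rightarrow> real) \<Rightarrow> real \<Rightarrow>
      (('v, 'l) param \<Rightarrow> real) \<Rightarrow> real"
  where "prior_density I \<D> s \<alpha> \<theta> = inverse (prior_const I \<D> s \<alpha>) * prior_kernel I \<D> s \<alpha> \<theta>"


section \<open>The induced prior\<close>

definition alpha_cell ::
    "('v \<Rightarrow> 'l::zero set) \<Rightarrow> 'v set set \<Rightarrow> (('v, 'l) param \<Rightarrow> real) \<Rightarrow>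
      'v set \<Rightarrow> ('v \<Rightarrow> 'l) \<Rightarrow> real"
  where "alpha_cell I \<D> s D i =
    (\<Sum>F\<in>{F\<in>\<D>. D \<subseteq> F}. \<Sum>j\<in>{j\<in>star_cells I F. restrict j D = i}.
      (-1) ^ card (F - D) * s (F, j))"

definition alpha_empty ::
    "('v \<Rightarrow> 'l::zero set) \<Rightarrow> 'v set set \<Rightarrow> (('v, 'l) param \<Rightarrow> real) \<Rightarrow> real \<Rightarrow> real"
  where "alpha_empty I \<D> s \<alpha> =
    \<alpha> + (\<Sum>D\<in>\<D>. \<Sum>i\<in>star_cells I D. (-1) ^ card D * s (D, i))"

text \<open>The density of the induced prior, with all cell probabilities evaluated at the point \<open>\<theta>\<close>
  that parametrises \<open>p\<^sub>\<D>\<close>. The map from \<open>\<theta>\<^sub>\<D>\<close> to \<open>p\<^sub>\<D>\<close> need not be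
  injective (independence of two binary variables is an example), so the other cell probabilities
  are functions of \<open>p\<^sub>\<D>\<close> only on a region where it is. Where the Jacobian vanishes, the value is
  \<open>0\<close> by the convention \<open>inverse 0 = 0\<close>.\<close>

definition induced_density ::
    "('v::finite \<Rightarrow> 'l::zero set) \<Rightarrow> 'v set set \<Rightarrow> (('v, 'l) param \<Rightarrow> real) \<Rightarrow> real \<Rightarrow>
      (('v, 'l) param \<Rightarrow> real) \<Rightarrow> real"
  where "induced_density I \<D> s \<alpha> \<theta> =
    inverse (Kfun I \<D> \<theta>) / prior_const I \<D> s \<alpha> *
    (\<Prod>D\<in>\<D>. \<Prod>i\<in>star_cells I D. cell_prob I \<D> \<theta> D i powr (alpha_cell I \<D> s D i - 1)) *
    prob_empty I \<D> \<theta> powr (alpha_empty I \<D> s \<alpha> - 1)"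


section \<open>Graphical models\<close>

text \<open>An undirected simple graph is given by its symmetric irreflexive adjacency relation.\<close>

definition complete_set :: "('v \<times> 'v) set \<Rightarrow> 'v set \<Rightarrow> bool"
  where "complete_set G C \<longleftrightarrow> (\<forall>x\<in>C. \<forall>y\<in>C. x \<noteq> y \<longrightarrow> (x, y) \<in> G)"

definition cliques :: "('v \<times> 'v) set \<Rightarrow> 'v set set"
  where "cliques G = {C. complete_set G C \<and> (\<forall>B. complete_set G B \<and> C \<subseteq> B \<longrightarrow> B = C)}"

definition connected_in :: "('v \<times> 'v) set \<Rightarrow> 'v set \<Rightarrow> bool"
  where "connected_in G H \<longleftrightarrow> (\<forall>x\<in>H. \<forall>y\<in>H. (x, y) \<in> (G \<inter> H \<times> H)\<^sup>*)"

definition cycle_in :: "('v \<times> 'v) set \<Rightarrow> 'v set \<Rightarrow> 'v list \<Rightarrow> bool"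
  where "cycle_in G H c \<longleftrightarrow> 3 \<le> length c \<and> distinct c \<and> set c \<subseteq> H \<and>
    (\<forall>k<length c. (c ! k, c ! (Suc k mod length c)) \<in> G)"

definition has_chord :: "('v \<times> 'v) set \<Rightarrow> 'v list \<Rightarrow> bool"
  where "has_chord G c \<longleftrightarrow> (\<exists>j<length c. \<exists>k<length c. (c ! j, c ! k) \<in> G \<and>
    k \<noteq> Suc j mod length c \<and> j \<noteq> Suc k mod length c)"

definition chordal_in :: "('v \<times> 'v) set \<Rightarrow> 'v set \<Rightarrow> bool"
  where "chordal_in G H \<longleftrightarrow> (\<forall>c. cycle_in G H c \<and> 4 \<le> length c \<longrightarrow> has_chord G c)"

definition U_ominus :: "('v \<times> 'v) set \<Rightarrow> 'v set set"
  where "U_ominus G = {H. H \<noteq> {} \<and> (\<not> chordal_in G H \<or> \<not> connected_in G H)}"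

text \<open>The elements of \<open>\<D>\<close> are nonempty, so the exponent \<open>card C - 1\<close> is not truncated.\<close>

definition a_coeff :: "'v set set \<Rightarrow> 'v set \<Rightarrow> real"
  where "a_coeff \<D> H = (\<Sum>C\<in>{C\<in>\<D>. C \<subseteq> H}. (-1) ^ (card C - 1)) - 1"

end

theory Submission
  imports Defs
begin

text \<open>
  \<^emph>\<open>The Jacobian.\<close> Index the coordinates of \<open>\<theta>\<^sub>\<D>\<close> by pairs \<open>d = (F, j)\<close> and write \<open>d \<le> c\<close> when
  \<open>d\<close> is a restriction of the marginal cell \<open>c = (D, i)\<close> (the relation \<open>below\<close>). Differentiating
  \<open>p c = exp (\<Sum>d\<le>c. \<theta> d) / Z\<close> gives the matrix \<open>p c * ([d \<le> c] - q d)\<close>, where \<open>q d\<close> is the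
  marginal probability of \<open>d\<close>. With \<open>L = ([d \<le> c])\<close>, which is unitriangular for the ordering by
  \<open>card F\<close>, and \<open>u d = (-1) ^ (card F - 1)\<close>, one has \<open>L u = 1\<close>: the nonempty faces of a simplex have
  alternating sum \<open>1\<close>. So the matrix is \<open>diag p * L * (1 - u q\<^sup>T)\<close> and its determinant is
  \<open>(\<Prod>p) * (1 - q \<bullet> u)\<close>. Exchanging sums turns \<open>q \<bullet> u\<close> into \<open>\<Sum>\<^sub>c p c * euler H\<close> over all cells
  \<open>c\<close> with support \<open>H\<close>, where \<open>euler H\<close> is the Euler characteristic of the simplicial complex that
  \<open>\<D>\<close> induces on \<open>H\<close> (\<open>jacobian_eq\<close>).

  \<^emph>\<open>Graphical models.\<close> Since the cell probabilities sum to \<open>1\<close>, only the sets \<open>H\<close> with \<open>euler H \<noteq> 1\<close>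
  survive besides \<open>p\<^sub>\<emptyset>\<close>. The clique complex of a chordal graph has Euler characteristic equal to its
  number of connected components (\<open>clique_euler_chordal\<close>), so a nonempty \<open>H\<close> that is chordal and
  connected does not contribute. That fact is proved by deleting a vertex \<open>v\<close> with neighbourhood \<open>N\<close>:
  the Euler characteristic changes by \<open>1 - euler N\<close>, and the number of components by one minus the
  number of components of \<open>N\<close>, because in a chordal graph two neighbours of \<open>v\<close> that are connected
  without \<open>v\<close> are connected inside \<open>N\<close>.

  \<^emph>\<open>The induced prior.\<close> The map to \<open>p\<^sub>\<D>\<close> need not be injective, so the change of variables takes the
  form of an area formula: the image of the density \<open>h * \<bar>det\<bar>\<close> is the sum of \<open>h\<close> over the fibre.
  Near a point with nonzero Jacobian the inverse function theorem applies, countably many such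
  neighbourhoods cover the regular points, and on each piece the change of variables theorem holds
  (\<open>area_formula\<close>, transferred to \<open>\<Pi>\<^sub>M\<close> in \<open>area_formula_PiM\<close>). It remains to see that critical points
  form a null set: up to positive factors the Jacobian is a combination of terms \<open>exp (\<Sum>d\<in>T. \<theta> d)\<close>
  whose constant coefficient is positive, since it counts the cells whose support contains no member of
  \<open>\<D>\<close>, and such a function is almost everywhere nonzero by Fubini (\<open>AE_jacobian_nonzero\<close>).

  \<^emph>\<open>The hyperparameters.\<close> Moebius inversion recovers \<open>\<theta> d\<close> from the values \<open>ln (p c / p\<^sub>\<emptyset>)\<close> with
  \<open>c \<le> d\<close>, so with the exponents \<open>\<alpha>(i(D))\<close> the product
  \<open>(\<Prod>c. p c powr \<alpha> c) * p\<^sub>\<emptyset> powr \<alpha>\<^sub>\<emptyset>\<close> is the kernel of the prior. Therefore the asserted density is the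
  prior density divided by the absolute Jacobian (\<open>induced_density_eq\<close>), and the area formula gives
  both statements on the image measure.
\<close>

section \<open>Determinants\<close>

text \<open>Extending a matrix by the identity outside \<open>S\<close> leaves only the permutations that fix the
  complement of \<open>S\<close>. This makes the library's theory of \<open>det\<close> available for \<open>det_on\<close>.\<close>
lemma det_on_eq_det:
  fixes M :: "'a::finite \<Rightarrow> 'a \<Rightarrow> real"
  assumes "\<And>c d. c \<notin> S \<Longrightarrow> M c d = of_bool (c = d)"
  shows "det_on S M = det (\<chi> c d. M c d)"
proof -
  have "det (\<chi> c d. M c d) = (\<Sum>\<pi>\<in>{\<pi>. \<pi> permutes UNIV}. of_int (sign \<pi>) * (\<Prod>c\<in>UNIV. M c (\<pi> c)))"
    by (simp add: det_def)
  also have "\<dots> = (\<Sum>\<pi>\<in>{\<pi>. \<pi> permutes S}. of_int (sign \<pi>) * (\<Prod>c\<in>UNIV. M c (\<pi> c)))"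
  proof (rule sum.mono_neutral_right)
    show "{\<pi>. \<pi> permutes S} \<subseteq> {\<pi>. \<pi> permutes UNIV}"
      using permutes_subset by blast
    show "\<forall>\<pi>\<in>{\<pi>. \<pi> permutes UNIV} - {\<pi>. \<pi> permutes S}. of_int (sign \<pi>) * (\<Prod>c\<in>UNIV. M c (\<pi> c)) = 0"
    proof
      fix \<pi> :: "'a \<Rightarrow> 'a"
      assume "\<pi> \<in> {\<pi>. \<pi> permutes UNIV} - {\<pi>. \<pi> permutes S}"
      then obtain c where "c \<notin> S" "\<pi> c \<noteq> c"
        by (auto simp: permutes_def)
      then have "M c (\<pi> c) = 0"
        using assms by auto
      then show "of_int (sign \<pi>) * (\<Prod>c\<in>UNIV. M c (\<pi> c)) = 0"
        by (simp add: prod_zero_iff) blast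
    qed
  qed simp
  also have "\<dots> = det_on S M"
    unfolding det_on_def
  proof (intro sum.cong refl arg_cong2[where f="(*)"])
    fix \<pi> assume "\<pi> \<in> {\<pi>. \<pi> permutes S}"
    then show "(\<Prod>c\<in>UNIV. M c (\<pi> c)) = (\<Prod>c\<in>S. M c (\<pi> c))"
      using assms by (intro prod.mono_neutral_right) (auto simp: permutes_def)
  qed
  finally show ?thesis by simp
qed

text \<open>Triangularity is measured by a rank function, because the relevant order on the indices is only
  partial: a permutation that never increases the rank preserves it, since the ranks have the same sum.\<close>
lemma det_unitriangular:
  fixes M :: "'a::finite \<Rightarrow> 'a \<Rightarrow> real" and r :: "'a \<Rightarrow> nat"
  assumes diag: "\<And>c. M c c = 1" and tri: "\<And>c d. M c d \<noteq> 0 \<Longrightarrow> c = d \<or> r d < r c"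
  shows "det (\<chi> c d. M c d) = 1"
proof -
  have "(\<Prod>c\<in>UNIV. M c (\<pi> c)) = 0" if \<pi>: "\<pi> permutes UNIV" "\<pi> \<noteq> id" for \<pi>
  proof (rule ccontr)
    assume "(\<Prod>c\<in>UNIV. M c (\<pi> c)) \<noteq> 0"
    then have nz: "M c (\<pi> c) \<noteq> 0" for c
      by (simp add: prod_zero_iff)
    have le: "r (\<pi> c) \<le> r c" for c
      using tri[OF nz[of c]] by auto
    obtain c where c: "\<pi> c \<noteq> c"
      using \<pi>(2) by (auto simp: fun_eq_iff)
    then have "r (\<pi> c) < r c"
      using tri[OF nz[of c]] by auto
    then have "(\<Sum>c\<in>UNIV. r (\<pi> c)) < (\<Sum>c\<in>UNIV. r c)"
      using le by (intro sum_strict_mono_ex1) auto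
    moreover have "(\<Sum>c\<in>UNIV. r (\<pi> c)) = (\<Sum>c\<in>UNIV. r c)"
      using sum.permute[OF \<pi>(1), of r] by (simp add: comp_def)
    ultimately show False by simp
  qed
  then have "det (\<chi> c d. M c d) = (\<Sum>\<pi>\<in>{id :: 'a \<Rightarrow> 'a}. of_int (sign \<pi>) * (\<Prod>c\<in>UNIV. M c (\<pi> c)))"
    unfolding det_def by (intro sum.mono_neutral_cong_right) (auto simp: permutes_id)
  then show ?thesis
    by (simp add: diag sign_id)
qed

text \<open>The matrix determinant lemma. The rows are changed from \<open>axis i 1\<close> to \<open>axis i 1 - u i *s q\<close> one
  at a time; the correction contributed by row \<open>k\<close> is a determinant whose row \<open>k\<close> is \<open>q\<close>, and adding
  multiples of that row to the others removes every trace of \<open>u\<close> from it.\<close>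
lemma det_rank_one_update:
  fixes u :: "'a::finite \<Rightarrow> real" and q :: "real^'a"
  shows "det (\<chi> i. axis i 1 - u i *s q) = 1 - (\<Sum>i\<in>UNIV. u i * q $ i)"
proof -
  have row_q: "det (\<chi> i. if i = k then q else if i \<in> T then axis i 1 - u i *s q else axis i 1) = q $ k"
    if "k \<notin> T" for k T
    using finite[of T] that
  proof (induction T)
    case empty
    have row: "row i (mat 1 :: real^'a^'a) = axis i 1" for i
      by (vector row_def mat_def axis_def)
    have "(\<Sum>i\<in>UNIV. q $ i *s axis i 1) = q"
      by (vector axis_def) (simp add: if_distrib if_distribR cong: if_cong)
    then show ?case
      using cramer_lemma_transpose[where k=k and A="mat 1" and x=q] unfolding row by (simp only: det_I mult_1_right empty_iff if_False)
  next
    case (insert t T)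
    let ?A = "\<chi> i. if i = k then q else if i \<in> T then axis i 1 - u i *s q else axis i 1"
    have rows: "row t ?A = axis t 1" "row k ?A = q"
      using insert by (auto simp: row_def vec_eq_iff)
    have "(\<chi> i. if i = k then q else if i \<in> insert t T then axis i 1 - u i *s q else axis i 1)
        = (\<chi> i. if i = t then row t ?A + (- u t) *s row k ?A else row i ?A)"
      unfolding rows using insert by (auto simp: vec_eq_iff row_def)
    then show ?case
      using det_row_operation[of t k ?A "- u t"] insert by auto
  qed
  have "det (\<chi> i. if i \<in> T then axis i 1 - u i *s q else axis i 1) = 1 - (\<Sum>i\<in>T. u i * q $ i)" for T
    using finite[of T]
  proof (induction T)
    case empty
    have "(\<chi> i. axis i 1) = (mat 1 :: real^'a^'a)"
      by (vector axis_def mat_def)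
    then show ?case by simp
  next
    case (insert k T)
    let ?c = "\<lambda>i. if i \<in> T then axis i 1 - u i *s q else axis i 1"
    have "(\<chi> i. if i \<in> insert k T then axis i 1 - u i *s q else axis i 1)
        = (\<chi> i. if i = k then axis i 1 + (- u k) *s q else ?c i)"
      by (auto simp: vec_eq_iff)
    then have "det (\<chi> i. if i \<in> insert k T then axis i 1 - u i *s q else axis i 1)
        = det (\<chi> i. if i = k then axis i 1 else ?c i)
          + det (\<chi> i. if i = k then (- u k) *s q else ?c i)"
      by (simp add: det_row_add)
    also have "(\<chi> i. if i = k then axis i 1 else ?c i) = (\<chi> i. ?c i)"
      using insert by (auto simp: vec_eq_iff)
    also have "det (\<chi> i. if i = k then (- u k) *s q else ?c i) = (- u k) * q $ k"
      using insert row_q[of k T] by (simp add: det_row_mul)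
    finally show ?case
      using insert by simp
  qed
  from this[of UNIV] show ?thesis
    by simp
qed

section \<open>Cell probabilities of a hierarchical model\<close>

text \<open>The Euler characteristic of a full simplex is \<open>1\<close>.\<close>
lemma sum_power_minus_one_nonempty_subsets:
  assumes "finite E" "E \<noteq> {}"
  shows "(\<Sum>F | F \<subseteq> E \<and> F \<noteq> {}. (-1) ^ (card F - 1)) = (1::real)"
proof -
  have "card E > 0"
    using assms by (simp add: card_gt_0_iff)
  then have "(\<Sum>F\<in>Pow E. (-1::real) ^ card F) = 0"
    using prod_diff_conv_sum[OF assms(1), of "\<lambda>_. 1" "\<lambda>_. 1::real"] by (simp add: zero_power)
  moreover have "(\<Sum>F\<in>Pow E. (-1::real) ^ card F) = 1 + (\<Sum>F\<in>Pow E - {{}}. (-1) ^ card F)"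
    using assms by (subst sum.remove[of _ "{}"]) auto
  moreover have "(\<Sum>F\<in>Pow E - {{}}. (-1::real) ^ card F) = - (\<Sum>F\<in>Pow E - {{}}. (-1) ^ (card F - 1))"
    unfolding sum_negf[symmetric]
  proof (rule sum.cong)
    fix F assume "F \<in> Pow E - {{}}"
    then have "card F > 0"
      using assms(1) by (auto simp: card_gt_0_iff finite_subset)
    then show "(-1::real) ^ card F = - ((-1) ^ (card F - 1))"
      by (cases "card F") auto
  qed simp
  ultimately show ?thesis
    by (simp add: Pow_def set_diff_eq)
qed

text \<open>Moebius inversion on the subsets of \<open>F\<close>: the symmetric inclusion-exclusion principle, with the
  signs absorbed into the summand on one side.\<close>
lemma moebius_subsets:
  fixes f :: "'v::finite set \<Rightarrow> real"
  shows "(\<Sum>D\<in>Pow F. (-1) ^ card (F - D) * (\<Sum>E\<in>Pow D. f E)) = f F"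
proof -
  have sq: "(-1) ^ card X * ((-1) ^ card X * y) = y" for X :: "'v set" and y :: real
    by (simp flip: mult.assoc power_add mult_2)
  have "(-1) ^ card F * f F = (\<Sum>D\<in>Pow F. (-1) ^ card D * (\<Sum>E\<in>Pow D. f E))"
    by (rule inclusion_exclusion_symmetric) (simp_all add: sq)
  then have "f F = (-1) ^ card F * (\<Sum>D\<in>Pow F. (-1) ^ card D * (\<Sum>E\<in>Pow D. f E))"
    by (metis sq)
  also have "\<dots> = (\<Sum>D\<in>Pow F. (-1) ^ card F * ((-1) ^ card D * (\<Sum>E\<in>Pow D. f E)))"
    by (rule sum_distrib_left)
  also have "\<dots> = (\<Sum>D\<in>Pow F. (-1) ^ card (F - D) * (\<Sum>E\<in>Pow D. f E))"
  proof (rule sum.cong)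
    fix D assume "D \<in> Pow F"
    then have "card F = card (F - D) + card D"
      by (simp add: card_Diff_subset card_mono)
    then show "(-1) ^ card F * ((-1) ^ card D * (\<Sum>E\<in>Pow D. f E)) = (-1) ^ card (F - D) * (\<Sum>E\<in>Pow D. f E)"
      by (simp add: power_add sq mult.assoc)
  qed simp
  finally show ?thesis by simp
qed

text \<open>The order on marginal cells by restriction. It turns sums over subsets of a support into sums over
  indices, so that the model becomes a plain exponential family indexed by a poset.\<close>
definition below :: "('v, 'l) param \<Rightarrow> ('v, 'l) param \<Rightarrow> bool"
  where "below d c \<longleftrightarrow> fst d \<subseteq> fst c \<and> snd d = restrict (snd c) (fst d)"

lemma params_mono: "\<D> \<subseteq> \<E> \<Longrightarrow> params I \<D> \<subseteq> params I \<E>"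
  by (auto simp: params_def)

lemma restrict_star_cells: "i \<in> star_cells I E \<Longrightarrow> F \<subseteq> E \<Longrightarrow> restrict i F \<in> star_cells I F"
  by (auto simp: star_cells_def)

lemma sum_params_below:
  assumes "i \<in> star_cells I E"
  shows "(\<Sum>d\<in>{d \<in> params I \<D>. below d (E, i)}. f d) = (\<Sum>F\<in>{F\<in>\<D>. F \<subseteq> E}. f (F, restrict i F))"
  by (rule sum.reindex_bij_witness[of _ "\<lambda>F. (F, restrict i F)" fst])
     (auto simp: below_def params_def restrict_star_cells[OF assms])

lemma below_refl: "c \<in> params I \<D> \<Longrightarrow> below c c"
  by (auto simp: below_def params_def star_cells_def)

text \<open>The interaction sets form an abstract simplicial complex without its empty face.\<close>
locale hierarchical_model =
  fixes I :: "'v::finite \<Rightarrow> 'l::{finite,zero} set" and \<D> :: "'v set set"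
  assumes empty_notin: "{} \<notin> \<D>"
    and down_closed: "E \<in> \<D> \<Longrightarrow> F \<subseteq> E \<Longrightarrow> F \<noteq> {} \<Longrightarrow> F \<in> \<D>"
begin

abbreviation S :: "('v, 'l) param set" where "S \<equiv> params I \<D>"

text \<open>A cell is represented by its support and its nonzero levels there, so that parameters and cells
  have the same type and \<open>i\<^sup>*\<close> is the pair with empty support.\<close>
abbreviation cells :: "('v, 'l) param set" where "cells \<equiv> params I UNIV"

text \<open>The quantity \<open>ln (p c / p\<^sub>\<emptyset>)\<close>, linear in \<open>\<theta>\<close> with coefficients \<open>0\<close> and \<open>1\<close>.\<close>
definition cell_logit :: "(('v, 'l) param \<Rightarrow> real) \<Rightarrow> ('v, 'l) param \<Rightarrow> real"
  where "cell_logit \<theta> c = (\<Sum>d\<in>{d \<in> S. below d c}. \<theta> d)"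

definition prob :: "(('v, 'l) param \<Rightarrow> real) \<Rightarrow> ('v, 'l) param \<Rightarrow> real"
  where "prob \<theta> c = exp (cell_logit \<theta> c) / Zfun I \<D> \<theta>"

text \<open>The partial derivative of \<open>ln Z\<close> with respect to \<open>\<theta> d\<close>.\<close>
definition marginal :: "(('v, 'l) param \<Rightarrow> real) \<Rightarrow> ('v, 'l) param \<Rightarrow> real"
  where "marginal \<theta> d = (\<Sum>c\<in>{c\<in>cells. below d c}. prob \<theta> c)"

lemma S_subset_cells: "S \<subseteq> cells"
  by (intro params_mono) simp

lemma log_odds_eq_cell_logit: "i \<in> star_cells I E \<Longrightarrow> log_odds \<D> \<theta> E i = cell_logit \<theta> (E, i)"
  by (simp add: log_odds_def cell_logit_def sum_params_below)

lemma star_cells_empty: "star_cells J {} = {\<lambda>_. undefined}"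
  by (auto simp: star_cells_def)

lemma cell_logit_empty: "cell_logit \<theta> ({}, i) = 0"
proof -
  have "{d \<in> S. below d ({}, i)} = {}"
    using empty_notin by (auto simp: below_def params_def)
  then show ?thesis
    unfolding cell_logit_def by (simp only: sum.empty)
qed

lemma sum_cells:
  "(\<Sum>c\<in>cells. f c) = f ({}, \<lambda>_. undefined) + (\<Sum>E\<in>{E. E \<noteq> {}}. \<Sum>i\<in>star_cells I E. f (E, i))"
proof -
  have "(\<Sum>c\<in>cells. f c) = (\<Sum>E\<in>UNIV. \<Sum>i\<in>star_cells I E. f (E, i))"
    by (simp add: params_def sum.Sigma)
  also have "\<dots> = (\<Sum>i\<in>star_cells I {}. f ({}, i)) + (\<Sum>E\<in>UNIV - {{}}. \<Sum>i\<in>star_cells I E. f (E, i))"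
    by (intro sum.remove) auto
  also have "UNIV - {{}} = {E :: 'v set. E \<noteq> {}}"
    by auto
  finally show ?thesis
    by (simp add: star_cells_empty)
qed

lemma Zfun_eq: "Zfun I \<D> \<theta> = (\<Sum>c\<in>cells. exp (cell_logit \<theta> c))"
  by (simp add: Zfun_def sum_cells cell_logit_empty log_odds_eq_cell_logit)

lemma Zfun_pos: "Zfun I \<D> \<theta> > 0"
  unfolding Zfun_def by (intro add_pos_nonneg sum_nonneg) auto

lemma cell_prob_eq: "i \<in> star_cells I E \<Longrightarrow> cell_prob I \<D> \<theta> E i = prob \<theta> (E, i)"
  by (simp add: cell_prob_def prob_def log_odds_eq_cell_logit field_simps)

lemma prob_empty_eq: "prob_empty I \<D> \<theta> = prob \<theta> ({}, \<lambda>_. undefined)"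
  by (simp add: prob_empty_def prob_def cell_logit_empty field_simps)

lemma prob_pos: "prob \<theta> c > 0"
  by (simp add: prob_def Zfun_pos)

lemma sum_prob: "(\<Sum>c\<in>cells. prob \<theta> c) = 1"
  using Zfun_pos[of \<theta>] by (simp add: prob_def Zfun_eq flip: sum_divide_distrib)

lemma prob_param_eq: "prob_param I \<D> \<theta> = restrict (prob \<theta>) S"
  by (auto simp: prob_param_def params_def restrict_def fun_eq_iff cell_prob_eq)

lemma prod_params: "(\<Prod>D\<in>\<D>. \<Prod>i\<in>star_cells I D. f (D, i)) = (\<Prod>d\<in>S. f d)"
  by (simp add: params_def prod.Sigma)

lemma sum_params: "(\<Sum>D\<in>\<D>. \<Sum>i\<in>star_cells I D. f (D, i)) = (\<Sum>d\<in>S. f d)"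
  by (simp add: params_def sum.Sigma)

lemma prod_cell_prob:
  "(\<Prod>D\<in>\<D>. \<Prod>i\<in>star_cells I D. cell_prob I \<D> \<theta> D i) = (\<Prod>d\<in>S. prob \<theta> d)"
  by (simp add: cell_prob_eq flip: prod_params)

lemma cell_logit_fun_upd: 
  assumes "d \<in> S"
  shows "cell_logit (\<theta>(d := t)) c = cell_logit \<theta> c + of_bool (below d c) * (t - \<theta> d)"
proof (cases "below d c")
  case True
  let ?B = "{d \<in> S. below d c}"
  define \<theta>' where "\<theta>' = \<theta>(d := t)"
  have "cell_logit \<theta>' c = t + (\<Sum>e\<in>?B - {d}. \<theta>' e)"
    unfolding cell_logit_def using assms True by (subst sum.remove[of _ d]) (auto simp: \<theta>'_def)
  also have "(\<Sum>e\<in>?B - {d}. \<theta>' e) = (\<Sum>e\<in>?B - {d}. \<theta> e)"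
    by (intro sum.cong) (auto simp: \<theta>'_def)
  also have "\<dots> = cell_logit \<theta> c - \<theta> d"
    unfolding cell_logit_def using assms True by (subst sum.remove[of ?B d]) auto
  finally show ?thesis
    using True unfolding \<theta>'_def[symmetric] by simp
next
  case False
  then have "(\<Sum>e\<in>{e \<in> S. below e c}. (\<theta>(d := t)) e) = (\<Sum>e\<in>{e \<in> S. below e c}. \<theta> e)"
    by (intro sum.cong) auto
  with False show ?thesis
    unfolding cell_logit_def by (simp only: of_bool_eq mult_zero_left add_0_right)
qed

lemma DERIV_prob:
  assumes "d \<in> S"
  shows "((\<lambda>t. prob (\<theta>(d := t)) c) has_real_derivative
           prob \<theta> c * (of_bool (below d c) - marginal \<theta> d)) (at (\<theta> d))"
proof -
  let ?e = "\<lambda>c t. exp (cell_logit \<theta> c + of_bool (below d c) * (t - \<theta> d))"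
  have e: "((\<lambda>t. ?e c t) has_real_derivative of_bool (below d c) * exp (cell_logit \<theta> c)) (at (\<theta> d))" for c
    by (auto intro!: derivative_eq_intros)
  have Z: "((\<lambda>t. \<Sum>c\<in>cells. ?e c t) has_real_derivative
      (\<Sum>c\<in>cells. of_bool (below d c) * exp (cell_logit \<theta> c))) (at (\<theta> d))"
    by (intro DERIV_sum e)
  have "(\<Sum>c\<in>cells. of_bool (below d c) * exp (cell_logit \<theta> c)) = (\<Sum>c\<in>{c\<in>cells. below d c}. exp (cell_logit \<theta> c))"
    by (intro sum.mono_neutral_cong_right) auto
  also have "\<dots> = marginal \<theta> d * Zfun I \<D> \<theta>"
    using Zfun_pos[of \<theta>] by (simp add: marginal_def prob_def flip: sum_divide_distrib)
  finally have m: "(\<Sum>c\<in>cells. of_bool (below d c) * exp (cell_logit \<theta> c)) = marginal \<theta> d * Zfun I \<D> \<theta>" .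
  have "((\<lambda>t. ?e c t / (\<Sum>c\<in>cells. ?e c t)) has_real_derivative
      (of_bool (below d c) * exp (cell_logit \<theta> c) * Zfun I \<D> \<theta> - exp (cell_logit \<theta> c) * (marginal \<theta> d * Zfun I \<D> \<theta>))
       / (Zfun I \<D> \<theta> * Zfun I \<D> \<theta>)) (at (\<theta> d))"
    using Zfun_pos[of \<theta>]
    by (intro DERIV_cong[OF DERIV_divide[OF e Z]]) (simp_all add: m Zfun_eq[symmetric])
  also have "(of_bool (below d c) * exp (cell_logit \<theta> c) * Zfun I \<D> \<theta> - exp (cell_logit \<theta> c) * (marginal \<theta> d * Zfun I \<D> \<theta>))
       / (Zfun I \<D> \<theta> * Zfun I \<D> \<theta>) = prob \<theta> c * (of_bool (below d c) - marginal \<theta> d)"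
    using Zfun_pos[of \<theta>] by (simp add: prob_def field_simps)
  finally show ?thesis
    by (simp add: prob_def Zfun_eq cell_logit_fun_upd[OF assms])
qed

section \<open>The Jacobian\<close>

definition jac_matrix :: "(('v, 'l) param \<Rightarrow> real) \<Rightarrow> ('v, 'l) param \<Rightarrow> ('v, 'l) param \<Rightarrow> real"
  where "jac_matrix \<theta> c d = (if c \<in> S then of_bool (d \<in> S) * (prob \<theta> c * (of_bool (below d c) - marginal \<theta> d))
                         else of_bool (c = d))"

lemma jacobian_eq_det_on: "jacobian I \<D> \<theta> = det_on S (jac_matrix \<theta>)"
  unfolding jacobian_def det_on_def
proof (intro sum.cong prod.cong arg_cong2[where f="(*)"] refl)
  fix \<pi> c assume "\<pi> \<in> {\<pi>. \<pi> permutes S}" and c: "c \<in> S"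
  then have d: "\<pi> c \<in> S"
    by (simp add: permutes_in_image)
  show "deriv (\<lambda>t. prob_param I \<D> (\<theta>(\<pi> c := t)) c) (\<theta> (\<pi> c)) = jac_matrix \<theta> c (\<pi> c)"
    using DERIV_prob[OF d, THEN DERIV_imp_deriv] c d by (simp add: prob_param_eq jac_matrix_def)
qed

lemma jacobian_eq_det: "jacobian I \<D> \<theta> = det (\<chi> c d. jac_matrix \<theta> c d)"
  by (simp add: jacobian_eq_det_on det_on_eq_det jac_matrix_def)

text \<open>The Euler characteristic of the complex of faces contained in \<open>H\<close>.\<close>
definition euler :: "'v set \<Rightarrow> real"
  where "euler H = (\<Sum>F\<in>{F\<in>\<D>. F \<subseteq> H}. (-1) ^ (card F - 1))"

lemma euler_simplex: "H \<in> \<D> \<Longrightarrow> euler H = 1"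
proof -
  assume H: "H \<in> \<D>"
  then have "H \<noteq> {}" "{F\<in>\<D>. F \<subseteq> H} = {F. F \<subseteq> H \<and> F \<noteq> {}}"
    using down_closed empty_notin by auto
  then show ?thesis
    using sum_power_minus_one_nonempty_subsets[of H] by (simp add: euler_def)
qed

lemma sum_below_euler:
  assumes "c \<in> cells"
  shows "(\<Sum>d\<in>{d \<in> S. below d c}. (-1) ^ (card (fst d) - 1)) = euler (fst c)"
proof -
  obtain E i where c: "c = (E, i)" "i \<in> star_cells I E"
    using assms by (auto simp: params_def)
  show ?thesis
    using sum_params_below[OF c(2), where \<D>=\<D> and f="\<lambda>d. (-1) ^ (card (fst d) - 1) :: real"]
    by (simp add: euler_def c)
qed

text \<open>The factorisation \<open>diag p * L * (1 - u q\<^sup>T)\<close> is written on the full index type. Outside \<open>S\<close> the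
  entries of \<open>u\<close> and \<open>q\<close> are \<open>0\<close> and those of \<open>p\<close> are \<open>1\<close>, so that all three factors act there as the
  identity.\<close>
lemma jacobian_eq:
  "jacobian I \<D> \<theta> = (\<Prod>d\<in>S. prob \<theta> d) * (1 - (\<Sum>c\<in>cells. prob \<theta> c * euler (fst c)))"
proof -
  define u :: "('v, 'l) param \<Rightarrow> real" where "u d = of_bool (d \<in> S) * (-1) ^ (card (fst d) - 1)" for d
  define q :: "real^('v, 'l) param" where "q = (\<chi> d. of_bool (d \<in> S) * marginal \<theta> d)"
  define L :: "('v, 'l) param \<Rightarrow> ('v, 'l) param \<Rightarrow> real"
    where "L c d = of_bool (c = d \<or> c \<in> S \<and> d \<in> S \<and> below d c)" for c d
  define p where "p c = (if c \<in> S then prob \<theta> c else 1)" for c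
  (* The alternating sum over the faces of a simplex: the vector u solves L u = 1 on S. *)
  have Lu: "(\<Sum>e\<in>UNIV. L c e * u e) = of_bool (c \<in> S)" for c
  proof (cases "c \<in> S")
    case True
    then have "(\<Sum>e\<in>UNIV. L c e * u e) = (\<Sum>d\<in>{d \<in> S. below d c}. (-1) ^ (card (fst d) - 1))"
      by (intro sum.mono_neutral_cong_right) (auto simp: L_def u_def below_refl)
    also have "\<dots> = euler (fst c)"
      using True S_subset_cells by (intro sum_below_euler) auto
    also have "\<dots> = 1"
      using True by (intro euler_simplex) (auto simp: params_def)
    finally show ?thesis
      using True by simp
  next
    case False
    then show ?thesis
      by (intro trans[OF sum.neutral]) (auto simp: L_def u_def)
  qed
  let ?P = "\<chi> c d. if c = d then p c else 0"
  let ?L = "\<chi> c d. L c d"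
  let ?R = "\<chi> i. axis i 1 - u i *s q"
  have "(\<chi> c d. jac_matrix \<theta> c d) = ?P ** (?L ** ?R)"
  proof -
    have LR: "(?L ** ?R) $ c $ d = L c d - of_bool (c \<in> S) * q $ d" for c d
    proof -
      have "(?L ** ?R) $ c $ d = (\<Sum>e\<in>UNIV. L c e * (of_bool (e = d) - u e * q $ d))"
        by (simp add: matrix_matrix_mult_def axis_def of_bool_def eq_commute)
      also have "\<dots> = L c d - (\<Sum>e\<in>UNIV. L c e * u e) * q $ d"
        by (simp add: right_diff_distrib sum_subtractf sum_distrib_right mult.assoc)
      finally show ?thesis
        by (simp add: Lu)
    qed
    moreover have "(?P ** A) $ c $ d = p c * A $ c $ d" for A :: "real^('v, 'l) param^('v, 'l) param" and c d
      by (simp add: matrix_matrix_mult_def if_distrib if_distribR cong: if_cong)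
    ultimately have "(?P ** (?L ** ?R)) $ c $ d = p c * (L c d - of_bool (c \<in> S) * q $ d)" for c d
      by (simp only:)
    moreover have "jac_matrix \<theta> c d = p c * (L c d - of_bool (c \<in> S) * q $ d)" for c d
      by (auto simp: jac_matrix_def p_def q_def L_def below_refl)
    ultimately show ?thesis
      by (simp add: vec_eq_iff)
  qed
  then have "jacobian I \<D> \<theta> = det ?P * (det ?L * det ?R)"
    by (simp add: jacobian_eq_det det_mul)
  also have "det ?L = 1"
  proof (rule det_unitriangular[where r="\<lambda>c. card (fst c)"])
    show "c = d \<or> card (fst d) < card (fst c)" if nz: "L c d \<noteq> 0" for c d
    proof (cases "c = d")
      case False
      then have b: "below d c" "c \<in> S" 
        using nz by (auto simp: L_def)
      then have "fst d \<noteq> fst c"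
        using False below_refl[OF b(2)] by (auto simp: below_def prod_eq_iff)
      then show ?thesis
        using b by (auto simp: below_def intro: psubset_card_mono)
    qed simp
  qed (simp add: L_def)
  also have "det ?P = (\<Prod>c\<in>UNIV. p c)"
    by (subst det_diagonal) auto
  also have "\<dots> = (\<Prod>c\<in>S. prob \<theta> c)"
    by (intro prod.mono_neutral_cong_right) (auto simp: p_def)
  also have "det ?R = 1 - (\<Sum>d\<in>UNIV. u d * q $ d)"
    by (rule det_rank_one_update)
  also have "(\<Sum>d\<in>UNIV. u d * q $ d) = (\<Sum>d\<in>S. (-1) ^ (card (fst d) - 1) * marginal \<theta> d)"
    by (intro sum.mono_neutral_cong_right) (auto simp: u_def q_def)
  also have "\<dots> = (\<Sum>d\<in>S. \<Sum>c\<in>cells. if below d c then (-1) ^ (card (fst d) - 1) * prob \<theta> c else 0)"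
    unfolding marginal_def sum_distrib_left
    by (intro sum.cong sum.mono_neutral_cong_left) auto
  also have "\<dots> = (\<Sum>c\<in>cells. \<Sum>d\<in>S. if below d c then (-1) ^ (card (fst d) - 1) * prob \<theta> c else 0)"
    by (rule sum.swap)
  also have "\<dots> = (\<Sum>c\<in>cells. \<Sum>d\<in>{d \<in> S. below d c}. (-1) ^ (card (fst d) - 1) * prob \<theta> c)"
    by (intro sum.cong sum.mono_neutral_cong_right) auto
  also have "\<dots> = (\<Sum>c\<in>cells. prob \<theta> c * euler (fst c))"
    by (simp add: mult.commute sum_distrib_left flip: sum_below_euler)
  finally show ?thesis
    by simp
qed

lemma euler_empty: "euler {} = 0"
proof -
  have "{F\<in>\<D>. F \<subseteq> {}} = {}" using empty_notin by auto
  then show ?thesis unfolding euler_def by (simp only: sum.empty)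
qed

lemma jacobian_general:
  "jacobian I \<D> \<theta> = (\<Prod>D\<in>\<D>. \<Prod>i\<in>star_cells I D. cell_prob I \<D> \<theta> D i) *
       (1 - (\<Sum>H\<in>{H. H \<noteq> {}}. \<Sum>l\<in>star_cells I H. cell_prob I \<D> \<theta> H l *
               (\<Sum>F\<in>{F\<in>\<D>. F \<subseteq> H}. (-1) ^ (card F - 1))))"
  unfolding jacobian_eq prod_cell_prob euler_def[symmetric]
  by (simp add: sum_cells euler_empty cell_prob_eq)

lemma a_coeff_eq: "a_coeff \<D> H = euler H - 1"
  by (simp only: a_coeff_def euler_def)

text \<open>Replacing \<open>1\<close> by the sum of all cell probabilities subtracts \<open>1\<close> from each Euler characteristic;
  the empty support, where it is \<open>0\<close>, produces the term \<open>p\<^sub>\<emptyset>\<close>.\<close>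
lemma jacobian_graphical:
  assumes "\<And>H. H \<noteq> {} \<Longrightarrow> H \<notin> U \<Longrightarrow> euler H = 1" and "{} \<notin> U"
  shows "jacobian I \<D> \<theta> = (\<Prod>D\<in>\<D>. \<Prod>i\<in>star_cells I D. cell_prob I \<D> \<theta> D i) *
         (prob_empty I \<D> \<theta> -
           (\<Sum>H\<in>U. \<Sum>i\<in>star_cells I H. cell_prob I \<D> \<theta> H i * a_coeff \<D> H))"
proof -
  have "1 - (\<Sum>c\<in>cells. prob \<theta> c * euler (fst c)) = - (\<Sum>c\<in>cells. prob \<theta> c * (euler (fst c) - 1))"
    by (simp add: right_diff_distrib sum_subtractf sum_prob)
  also have "\<dots> = prob_empty I \<D> \<theta> -
      (\<Sum>H\<in>{H. H \<noteq> {}}. \<Sum>i\<in>star_cells I H. cell_prob I \<D> \<theta> H i * a_coeff \<D> H)"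
    by (simp add: sum_cells euler_empty prob_empty_eq cell_prob_eq a_coeff_eq)
  also have "(\<Sum>H\<in>{H. H \<noteq> {}}. \<Sum>i\<in>star_cells I H. cell_prob I \<D> \<theta> H i * a_coeff \<D> H)
      = (\<Sum>H\<in>U. \<Sum>i\<in>star_cells I H. cell_prob I \<D> \<theta> H i * a_coeff \<D> H)"
    using assms by (intro sum.mono_neutral_right) (auto simp: a_coeff_eq)
  finally show ?thesis
    unfolding jacobian_eq prod_cell_prob by simp
qed

end

section \<open>The clique complex of a chordal graph\<close>

definition component :: "('v \<times> 'v) set \<Rightarrow> 'v set \<Rightarrow> 'v \<Rightarrow> 'v set"
  where "component G H x = {y. (x, y) \<in> (G \<inter> H \<times> H)\<^sup>*}"

definition clique_euler :: "('v \<times> 'v) set \<Rightarrow> 'v set \<Rightarrow> real"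
  where "clique_euler G H = (\<Sum>F | complete_set G F \<and> F \<noteq> {} \<and> F \<subseteq> H. (-1) ^ (card F - 1))"

lemma chordal_in_subset: "chordal_in G H \<Longrightarrow> H' \<subseteq> H \<Longrightarrow> chordal_in G H'"
  unfolding chordal_in_def cycle_in_def by blast

text \<open>Induction on the length of a walk from \<open>a\<close> to \<open>b\<close> that avoids \<open>v\<close>. If the walk can be shortened, or
  if it meets \<open>N\<close> in between, then shorter walks do the job. Otherwise it is an induced path whose inner
  vertices are not adjacent to \<open>v\<close>; if it has inner vertices, then together with \<open>v\<close> it is a cycle of
  length at least \<open>4\<close> without a chord.\<close>
lemma chordal_neighbours_connected:
  assumes G: "sym G" "irrefl G" and chordal: "chordal_in G H" and v: "v \<in> H"
    and H': "H' = H - {v}" and N: "N = {x \<in> H'. (v, x) \<in> G}"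
    and ab: "a \<in> N" "b \<in> N" "(a, b) \<in> (G \<inter> H' \<times> H')\<^sup>*"
  shows "(a, b) \<in> (G \<inter> N \<times> N)\<^sup>*"
proof -
  let ?R = "G \<inter> H' \<times> H'"
  have "(a, b) \<in> ?R ^^ n \<Longrightarrow> (a, b) \<in> (G \<inter> N \<times> N)\<^sup>*" for n
    using ab(1,2)
  proof (induction n arbitrary: a b rule: less_induct)
    case (less n)
    obtain f where f: "f 0 = a" "f n = b" "\<And>i. i < n \<Longrightarrow> (f i, f (Suc i)) \<in> ?R"
      using less.prems(1) by (auto simp: relpow_fun_conv)
    have seg: "(f i, f j) \<in> ?R ^^ (j - i)" if "i \<le> j" "j \<le> n" for i j
      unfolding relpow_fun_conv using that f(3)
      by (intro exI[of _ "\<lambda>k. f (i + k)"]) auto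
    have fH': "f i \<in> H'" if "i \<le> n" for i
      using that f less.prems(2,3) N by (cases "i = n") auto
    consider "n = 0" | "n = 1" | m where "m < n" "(a, b) \<in> ?R ^^ m"
      | k where "0 < k" "k < n" "f k \<in> N"
      | "n \<ge> 2" "\<And>m. m < n \<Longrightarrow> (a, b) \<notin> ?R ^^ m" "\<And>k. 0 < k \<Longrightarrow> k < n \<Longrightarrow> f k \<notin> N"
      by (metis One_nat_def Suc_1 less_2_cases not_less)
    then show ?case
    proof cases
      case 1
      then show ?thesis using less.prems by simp
    next
      case 2
      then show ?thesis using less.prems by auto
    next
      case 3
      then show ?thesis using less by blast
    next
      case 4
      have "(a, f k) \<in> (G \<inter> N \<times> N)\<^sup>*"
        using seg[of 0 k] 4 f less.prems by (intro less.IH[of k]) auto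
      moreover have "(f k, b) \<in> (G \<inter> N \<times> N)\<^sup>*"
        using seg[of k n] 4 f less.prems by (intro less.IH[of "n - k"]) auto
      ultimately show ?thesis by simp
    next
      case 5
      (* A repeated vertex or a shortcut would yield a shorter walk. *)
      have no_repeat: "f i \<noteq> f j" if "i < j" "j \<le> n" for i j
      proof
        assume eq: "f i = f j"
        have "(a, f i) \<in> ?R ^^ i" "(f i, b) \<in> ?R ^^ (n - j)"
          using seg[of 0 i] seg[of j n] that f eq by auto
        then have "(a, b) \<in> ?R ^^ (i + (n - j))"
          unfolding relpow_add by blast
        moreover have "i + (n - j) < n"
          using that by linarith
        ultimately show False
          using 5(2) by blast
      qed
      have no_shortcut: "(f i, f j) \<notin> G" if "Suc i < j" "j \<le> n" for i j
      proof
        assume "(f i, f j) \<in> G"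
        then have "(f i, f j) \<in> ?R ^^ 1"
          using that fH' by auto
        moreover have "(a, f i) \<in> ?R ^^ i" "(f j, b) \<in> ?R ^^ (n - j)"
          using seg[of 0 i] seg[of j n] that f by auto
        ultimately have "(a, b) \<in> ?R ^^ (i + (1 + (n - j)))"
          unfolding relpow_add by blast
        moreover have "i + (1 + (n - j)) < n"
          using that by linarith
        ultimately show False
          using 5(2) by blast
      qed
      (* The chordless cycle: position 0 is v, position k > 0 is f (k - 1). *)
      let ?c = "v # map f [0..<Suc n]"
      have len: "length ?c = n + 2"
        by simp
      have nth: "?c ! k = f (k - 1)" if "0 < k" "k < n + 2" for k
        using that by (simp add: nth_Cons' del: upt_Suc)
      have "inj_on f {0..<Suc n}"
        by (intro inj_onI) (metis atLeastLessThan_iff less_Suc_eq_le linorder_neqE_nat no_repeat)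
      moreover have "v \<notin> f ` {0..<Suc n}"
        using fH' H' by (metis DiffE imageE atLeastLessThan_iff less_Suc_eq_le singletonI)
      ultimately have "distinct ?c"
        by (simp add: distinct_map del: upt_Suc)
      moreover have "(?c ! k, ?c ! (Suc k mod length ?c)) \<in> G" if "k < length ?c" for k
      proof -
        consider "k = 0" | "0 < k" "k < n + 1" | "k = n + 1"
          using \<open>k < length ?c\<close> unfolding len by linarith
        then show ?thesis
        proof cases
          case 1
          then show ?thesis
            using less.prems f N unfolding len by (subst nth) auto
        next
          case 2
          then show ?thesis
            using f(3)[of "k - 1"] unfolding len by (simp add: nth del: nth_Cons_Suc list.map upt_Suc)
        next
          case 3
          have "(f n, v) \<in> G"
            using less.prems f N G by (auto dest: symD)
          then show ?thesis
            unfolding len 3 by (simp add: nth[of "n + 1", simplified] del: list.map upt_Suc)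
        qed
      qed
      ultimately have "cycle_in G H ?c"
        unfolding cycle_in_def using 5(1) v fH' H' by auto
      then have "has_chord G ?c"
        using chordal 5(1) unfolding chordal_in_def by auto
      then obtain j k where jk: "j < n + 2" "k < n + 2" "(?c ! j, ?c ! k) \<in> G"
          "k \<noteq> Suc j mod (n + 2)" "j \<noteq> Suc k mod (n + 2)"
        unfolding has_chord_def len by blast
      have False if "j < k" "k < n + 2" "(?c ! j, ?c ! k) \<in> G"
          "k \<noteq> Suc j mod (n + 2)" "j \<noteq> Suc k mod (n + 2)" for j k
      proof (cases "j = 0")
        case True
        then have "0 < k - 1" "k - 1 < n"
          using that by (auto simp: mod_Suc split: if_splits)
        moreover have "f (k - 1) \<in> N"
          using that True fH'[of "k - 1"] N by (subst (asm) (2) nth) auto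
        ultimately show False
          using 5(3) by blast
      next
        case False
        then show False
          using that no_shortcut[of "j - 1" "k - 1"] nth[of j] nth[of k] by auto
      qed
      moreover have "j \<noteq> k"
        using jk(3) G(2) by (auto simp: irrefl_def)
      moreover have "(?c ! k, ?c ! j) \<in> G"
        using jk(3) G(1) by (auto dest: symD)
      ultimately show ?thesis
        using jk by (metis linorder_neqE_nat)
    qed
  qed
  with ab show ?thesis
    by (auto simp: rtrancl_power)
qed

lemma component_eqI:
  assumes "sym G" "(x, y) \<in> (G \<inter> H \<times> H)\<^sup>*"
  shows "component G H x = component G H y"
proof -
  have "sym (G \<inter> H \<times> H)"
    using assms(1) by (auto simp: sym_def)
  then have "(y, x) \<in> (G \<inter> H \<times> H)\<^sup>*"
    using assms(2) by (meson sym_rtrancl symD)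
  with assms(2) show ?thesis
    by (auto simp: component_def)
qed

lemma component_eq_iff:
  "sym G \<Longrightarrow> component G H x = component G H y \<longleftrightarrow> (x, y) \<in> (G \<inter> H \<times> H)\<^sup>*"
  using component_eqI[of G x y H] by (auto simp: component_def)

lemma card_image_eq_if_same_fibres:
  assumes "\<And>x y. x \<in> A \<Longrightarrow> y \<in> A \<Longrightarrow> f x = f y \<longleftrightarrow> g x = g y"
  shows "card (f ` A) = card (g ` A)"
proof (rule bij_betw_same_card)
  have h: "g (inv_into A f (f x)) = g x" if "x \<in> A" for x
    using assms[of "inv_into A f (f x)" x] that by (simp add: f_inv_into_f inv_into_into)
  show "bij_betw (\<lambda>c. g (inv_into A f c)) (f ` A) (g ` A)"
    unfolding bij_betw_def inj_on_def using assms h by (auto simp: image_iff)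
qed

text \<open>Deleting \<open>v\<close> splits its component into the components of \<open>H'\<close> that meet \<open>N\<close>, and keeps the others
  (the set \<open>A0\<close>). Components of \<open>H'\<close> that meet \<open>N\<close> correspond to components of \<open>N\<close>; chordality is what
  makes this correspondence injective.\<close>
lemma card_components_remove_vertex:
  fixes G :: "('v::finite \<times> 'v) set"
  assumes G: "sym G" "irrefl G" and chordal: "chordal_in G H" and v: "v \<in> H"
    and H': "H' = H - {v}" and N: "N = {x \<in> H'. (v, x) \<in> G}"
  shows "card (component G H ` H) + card (component G N ` N) = card (component G H' ` H') + 1"
proof -
  define A0 where "A0 = {C \<in> component G H' ` H'. C \<inter> N = {}}"
  have sub: "(G \<inter> N \<times> N)\<^sup>* \<subseteq> (G \<inter> H' \<times> H')\<^sup>*" "(G \<inter> H' \<times> H')\<^sup>* \<subseteq> (G \<inter> H \<times> H)\<^sup>*"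
    using H' N by (auto intro!: rtrancl_mono)
  have "component G H' ` H' = A0 \<union> component G H' ` N"
  proof -
    have "component G H' x \<in> component G H' ` N" if "component G H' x \<inter> N \<noteq> {}" for x
      using that component_eqI[OF G(1), of x _ H'] by (force simp: component_def)
    then show ?thesis
      using N by (auto simp: A0_def)
  qed
  moreover have "A0 \<inter> component G H' ` N = {}"
    by (auto simp: A0_def component_def)
  ultimately have 1: "card (component G H' ` H') = card A0 + card (component G H' ` N)"
    by (simp add: card_Un_disjoint)
  have 2: "card (component G H' ` N) = card (component G N ` N)"
    using chordal_neighbours_connected[OF G chordal v H' N] sub G(1)
    by (intro card_image_eq_if_same_fibres) (auto simp: component_eq_iff)
  have far: "component G H x = component G H' x" if x: "x \<in> H'" "component G H' x \<inter> N = {}" for x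
  proof -
    have "(x, y) \<in> (G \<inter> H' \<times> H')\<^sup>*" if "(x, y) \<in> (G \<inter> H \<times> H)\<^sup>*" for y
      using that
    proof induction
      case (step y z)
      have "y \<notin> N"
        using step.IH x(2) by (auto simp: component_def)
      moreover have "y \<in> H'"
        using step.IH x(1) by (induction) auto
      ultimately have "z \<noteq> v"
        using step.hyps(2) G(1) N by (auto dest: symD)
      then show ?case
        using step \<open>y \<in> H'\<close> H' by (auto intro: rtrancl_into_rtrancl)
    qed auto
    then show ?thesis
      using sub by (auto simp: component_def)
  qed
  have near: "component G H x = component G H v" if x: "component G H' x \<inter> N \<noteq> {}" for x
  proof -
    obtain y where y: "(x, y) \<in> (G \<inter> H' \<times> H')\<^sup>*" "y \<in> N"
      using x by (auto simp: component_def)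
    have "(y, v) \<in> G \<inter> H \<times> H"
      using y(2) v H' N G(1) by (auto dest: symD)
    then have "(x, v) \<in> (G \<inter> H \<times> H)\<^sup>*"
      using y sub by (meson rtrancl_into_rtrancl subsetD)
    then show ?thesis
      by (rule component_eqI[OF G(1)])
  qed
  have "component G H ` H = insert (component G H v) A0"
  proof
    show "component G H ` H \<subseteq> insert (component G H v) A0"
    proof
      fix C assume "C \<in> component G H ` H"
      then obtain x where x: "x \<in> H" "C = component G H x" by blast
      show "C \<in> insert (component G H v) A0"
      proof (cases "x = v \<or> component G H' x \<inter> N \<noteq> {}")
        case True
        then show ?thesis using x near by auto
      next
        case False
        then show ?thesis using x far[of x] H' by (auto simp: A0_def)
      qed
    qed
    show "insert (component G H v) A0 \<subseteq> component G H ` H"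
    proof
      fix C assume "C \<in> insert (component G H v) A0"
      then consider "C = component G H v" | x where "x \<in> H'" "C = component G H' x" "C \<inter> N = {}"
        by (auto simp: A0_def)
      then show "C \<in> component G H ` H"
      proof cases
        case 2
        then show ?thesis using far[of x] H' by auto
      qed (use v in auto)
    qed
  qed
  moreover have "component G H v \<notin> A0"
  proof
    assume "component G H v \<in> A0"
    then obtain x where x: "x \<in> H'" "component G H v = component G H' x"
      by (auto simp: A0_def)
    then have "(x, v) \<in> (G \<inter> H' \<times> H')\<^sup>*"
      by (auto simp: component_def)
    then have "v \<in> H'"
      using x(1) by induction auto
    then show False using H' by auto
  qed
  ultimately have "card (component G H ` H) = card A0 + 1"
    by simp
  with 1 2 show ?thesis by simp
qed

lemma complete_set_insert:
  assumes "sym G" "v \<notin> T"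
  shows "complete_set G (insert v T) \<longleftrightarrow> complete_set G T \<and> (\<forall>x\<in>T. (v, x) \<in> G)"
  using assms unfolding complete_set_def by (auto dest: symD)

text \<open>The cliques through \<open>v\<close> are the sets \<open>insert v T\<close> with \<open>T\<close> a clique of \<open>N\<close>, possibly empty.\<close>
lemma clique_euler_remove_vertex:
  fixes G :: "('v::finite \<times> 'v) set"
  assumes G: "sym G" and v: "v \<in> H" and H': "H' = H - {v}" and N: "N = {x \<in> H'. (v, x) \<in> G}"
  shows "clique_euler G H = clique_euler G H' + 1 - clique_euler G N"
proof -
  let ?K = "\<lambda>H. {F. complete_set G F \<and> F \<noteq> {} \<and> F \<subseteq> H}"
  have vN: "v \<notin> N"
    using H' N by auto
  have ins: "insert v ` insert {} (?K N) = {F. complete_set G F \<and> F \<subseteq> H \<and> v \<in> F}"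
  proof
    show "insert v ` insert {} (?K N) \<subseteq> {F. complete_set G F \<and> F \<subseteq> H \<and> v \<in> F}"
    proof
      fix F assume "F \<in> insert v ` insert {} (?K N)"
      then obtain T where T: "F = insert v T" "T = {} \<or> complete_set G T" "T \<subseteq> N"
        by auto
      moreover have "complete_set G {}"
        by (simp add: complete_set_def)
      ultimately have "complete_set G F"
        using vN N by (subst T(1), subst complete_set_insert[OF G]) auto
      then show "F \<in> {F. complete_set G F \<and> F \<subseteq> H \<and> v \<in> F}"
        using T v H' N by auto
    qed
    show "{F. complete_set G F \<and> F \<subseteq> H \<and> v \<in> F} \<subseteq> insert v ` insert {} (?K N)"
    proof
      fix F assume "F \<in> {F. complete_set G F \<and> F \<subseteq> H \<and> v \<in> F}"
      then have F: "complete_set G F" "F \<subseteq> H" "F = insert v (F - {v})"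
        by auto
      then have "complete_set G (F - {v})" "\<forall>x\<in>F - {v}. (v, x) \<in> G"
        using complete_set_insert[OF G, of v "F - {v}"] by auto
      then have "F - {v} \<in> insert {} (?K N)"
        using F(2) H' N by auto
      then show "F \<in> insert v ` insert {} (?K N)"
        using F(3) by blast
    qed
  qed
  have inj: "inj_on (insert v) (insert {} (?K N))"
    using vN by (intro inj_onI) (auto simp: insert_eq_iff)
  have "?K H = ?K H' \<union> {F. complete_set G F \<and> F \<subseteq> H \<and> v \<in> F}"
    using H' by auto
  moreover have "?K H' \<inter> {F. complete_set G F \<and> F \<subseteq> H \<and> v \<in> F} = {}"
    using H' by auto
  ultimately have "clique_euler G H = clique_euler G H'
      + (\<Sum>F | complete_set G F \<and> F \<subseteq> H \<and> v \<in> F. (-1) ^ (card F - 1))"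
    unfolding clique_euler_def by (simp add: sum.union_disjoint)
  also have "(\<Sum>F | complete_set G F \<and> F \<subseteq> H \<and> v \<in> F. (-1) ^ (card F - 1))
      = (\<Sum>T\<in>insert {} (?K N). (-1 :: real) ^ card T)"
    unfolding ins[symmetric] sum.reindex[OF inj] using vN
    by (intro sum.cong refl) (auto simp: card_insert_if)
  also have "\<dots> = 1 + (\<Sum>T\<in>?K N. (-1) ^ card T)"
    by (subst sum.insert) auto
  also have "(\<Sum>T\<in>?K N. (-1 :: real) ^ card T) = (\<Sum>T\<in>?K N. - ((-1) ^ (card T - 1)))"
  proof (intro sum.cong refl)
    fix T assume "T \<in> ?K N"
    then have "card T > 0"
      by (auto simp: card_gt_0_iff)
    then show "(-1 :: real) ^ card T = - ((-1) ^ (card T - 1))"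
      by (cases "card T") auto
  qed
  finally show ?thesis
    by (simp add: clique_euler_def sum_negf)
qed

text \<open>Both sides change by the same amount when a vertex is deleted, and they vanish on the empty set. The
  induction has to cover disconnected sets, because \<open>H'\<close> and \<open>N\<close> need not be connected.\<close>
theorem clique_euler_chordal:
  fixes G :: "('v::finite \<times> 'v) set"
  assumes G: "sym G" "irrefl G" and "chordal_in G H"
  shows "clique_euler G H = card (component G H ` H)"
  using assms(3)
proof (induction "card H" arbitrary: H rule: less_induct)
  case less
  show ?case
  proof (cases "H = {}")
    case True
    then have "{F. complete_set G F \<and> F \<noteq> {} \<and> F \<subseteq> H} = {}" by auto
    then show ?thesis 
      using True unfolding clique_euler_def by (simp only: sum.empty) simp
  next
    case False
    then obtain v where v: "v \<in> H" by blast
    define H' where "H' = H - {v}"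
    define N where "N = {x \<in> H'. (v, x) \<in> G}"
    have "N \<subseteq> H'" "H' \<subset> H"
      using v by (auto simp: H'_def N_def)
    then have "card H' < card H" "card N < card H"
      by (auto intro!: psubset_card_mono)
    moreover have "chordal_in G H'" "chordal_in G N"
      using chordal_in_subset[OF less.prems] \<open>N \<subseteq> H'\<close> \<open>H' \<subset> H\<close> by auto
    ultimately have "clique_euler G H' = card (component G H' ` H')"
        "clique_euler G N = card (component G N ` N)"
      using less.hyps by auto
    then show ?thesis
      using clique_euler_remove_vertex[OF G(1) v H'_def N_def]
        card_components_remove_vertex[OF G less.prems v H'_def N_def] by linarith
  qed
qed

lemma clique_euler_chordal_connected:
  fixes G :: "('v::finite \<times> 'v) set"
  assumes "sym G" "irrefl G" "chordal_in G H" "connected_in G H" "H \<noteq> {}"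
  shows "clique_euler G H = 1"
proof -
  obtain x where x: "x \<in> H"
    using assms(5) by blast
  have "component G H y = component G H x" if "y \<in> H" for y
    using assms(1,4) x that by (auto simp: connected_in_def component_eq_iff)
  then have "component G H ` H = {component G H x}"
    using x by blast
  then show ?thesis
    using clique_euler_chordal[OF assms(1-3)] by simp
qed

text \<open>Every complete set extends to a maximal one, namely a complete superset of largest cardinality.\<close>
lemma interaction_sets_cliques:
  fixes G :: "('v::finite \<times> 'v) set"
  shows "interaction_sets (cliques G) = {F. complete_set G F \<and> F \<noteq> {}}"
proof
  show "interaction_sets (cliques G) \<subseteq> {F. complete_set G F \<and> F \<noteq> {}}"
    unfolding interaction_sets_def cliques_def complete_set_def by blast
  show "{F. complete_set G F \<and> F \<noteq> {}} \<subseteq> interaction_sets (cliques G)"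
  proof
    fix F assume F: "F \<in> {F. complete_set G F \<and> F \<noteq> {}}"
    obtain B where "complete_set G B \<and> F \<subseteq> B" and B: "\<And>C. complete_set G C \<and> F \<subseteq> C \<Longrightarrow> card C \<le> card B"
      using F ex_has_greatest_nat[of "\<lambda>C. complete_set G C \<and> F \<subseteq> C" F card "Suc (card (UNIV :: 'v set))"]
      by (auto simp: card_mono less_Suc_eq_le)
    moreover have "C = B" if "complete_set G C \<and> B \<subseteq> C" for C
      using that B[of C] \<open>complete_set G B \<and> F \<subseteq> B\<close> card_seteq[of C B] by auto
    ultimately show "F \<in> interaction_sets (cliques G)"
      using F unfolding interaction_sets_def cliques_def by blast
  qed
qed

section \<open>The area formula\<close>

text \<open>The change of variables theorem in the form needed for nonnegative integrands: \<open>\<phi>\<close> carries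
  \<open>\<bar>det D\<bar>\<close> times Lebesgue measure on \<open>U\<close> to Lebesgue measure on \<open>V\<close>. It suffices to compare the two
  measures on Borel sets; the bounds on \<open>U\<close> and \<open>det D\<close> make all the measures involved finite, so that
  the theorem on measures of differentiable images applies.\<close>
lemma nn_integral_image_diffeo:
  fixes \<phi> :: "real^'n::{finite,wellorder} \<Rightarrow> real^'n::_"
  assumes "open U" "open V" and hom: "homeomorphism U V \<phi> g"
    and der: "\<And>x. (\<phi> has_derivative (\<lambda>v. D x *v v)) (at x)"
    and detm: "(\<lambda>x. det (D x)) \<in> borel_measurable borel"
    and bdd: "emeasure lborel U < \<infinity>" "\<And>x. x \<in> U \<Longrightarrow> \<bar>det (D x)\<bar> \<le> B"
    and F [measurable]: "F \<in> borel_measurable borel"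
  shows "(\<integral>\<^sup>+y. indicator V y * F y \<partial>lborel)
    = (\<integral>\<^sup>+x. indicator U x * (F (\<phi> x) * ennreal \<bar>det (D x)\<bar>) \<partial>lborel)"
proof -
  note [measurable] = detm
  have [measurable]: "U \<in> sets borel" "V \<in> sets borel"
    using assms by auto
  have cont: "continuous_on UNIV \<phi>"
    using der by (meson continuous_at_imp_continuous_on has_derivative_continuous)
  then have [measurable]: "\<phi> \<in> borel_measurable borel"
    by (simp add: borel_measurable_continuous_onI)
  have V: "V = \<phi> ` U" and gV: "\<And>x. x \<in> U \<Longrightarrow> g (\<phi> x) = x" and "inj_on \<phi> U"
    using hom by (auto simp: homeomorphism_def intro: inj_on_inverseI)
  define \<mu> where "\<mu> = density lborel (\<lambda>x. indicator U x * ennreal \<bar>det (D x)\<bar>)"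
  have "distr \<mu> borel \<phi> = density lborel (indicator V)"
  proof (rule measure_eqI)
    fix A assume "A \<in> sets (distr \<mu> borel \<phi>)"
    then have A [measurable]: "A \<in> sets borel" by simp
    define W where "W = U \<inter> \<phi> -` A"
    have [measurable]: "W \<in> sets borel"
      unfolding W_def by (measurable)
    have img: "\<phi> ` W = V \<inter> A"
      by (auto simp: W_def V)
    have fin: "emeasure lborel W < \<infinity>"
      using bdd(1) by (intro le_less_trans[OF emeasure_mono[of W U]]) (auto simp: W_def)
    have "set_integrable lborel W (\<lambda>x. \<bar>det (D x)\<bar>)"
      unfolding set_integrable_def
    proof (rule integrableI_bounded_set_indicator[where B=B])
      show "AE x in lborel. x \<in> W \<longrightarrow> norm \<bar>det (D x)\<bar> \<le> B"
        using bdd(2) by (auto simp: W_def)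
    qed (use fin in \<open>auto simp: less_top\<close>)
    then have abs_int: "(\<lambda>x. \<bar>det (D x)\<bar>) absolutely_integrable_on W"
      by (simp add: set_integrable_def integrable_completion)
    have "emeasure lborel (V \<inter> A) = ennreal (measure lebesgue (\<phi> ` W))
        \<and> measure lebesgue (\<phi> ` W) = integral W (\<lambda>x. \<bar>det (D x)\<bar>)"
    proof -
      have W: "W \<in> sets lebesgue"
        by (metis \<open>W \<in> sets borel\<close> lborelD sets_completionI_sets sets_lborel)
      have der': "(\<phi> has_derivative (*v) (D x)) (at x within W)" for x
        using der has_derivative_at_withinI by blast
      have inj: "inj_on \<phi> W"
        using \<open>inj_on \<phi> U\<close> by (auto simp: W_def inj_on_def)
      have mat: "matrix ((*v) (D x)) = D x" for x
        by (simp add: matrix_of_matrix_vector_mul)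
      have int: "(\<lambda>x. \<bar>det (matrix ((*v) (D x)))\<bar>) integrable_on W"
        unfolding mat using abs_int set_lebesgue_integral_eq_integral(1) by blast
      have "\<phi> ` W \<in> lmeasurable"
        using measurable_differentiable_image_eq[OF W der' inj] int by blast
      then have "emeasure lebesgue (\<phi> ` W) = ennreal (measure lebesgue (\<phi> ` W))"
        by (rule emeasure_eq_measure2)
      moreover have "measure lebesgue (\<phi> ` W) = integral W (\<lambda>x. \<bar>det (D x)\<bar>)"
        using measure_differentiable_image_eq[OF W der' inj int] unfolding mat by simp
      ultimately show ?thesis
        by (simp add: img)
    qed
    also have "integral W (\<lambda>x. \<bar>det (D x)\<bar>) = (LINT x:W|lebesgue. \<bar>det (D x)\<bar>)"
      using abs_int by (simp add: set_lebesgue_integral_eq_integral(2))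
    also have "\<dots> = (LINT x:W|lborel. \<bar>det (D x)\<bar>)"
      unfolding set_lebesgue_integral_def by (intro integral_completion) measurable
    finally have 1: "emeasure lborel (V \<inter> A) = ennreal (LINT x:W|lborel. \<bar>det (D x)\<bar>)"
      by simp
    have [measurable]: "\<phi> -` A \<in> sets borel"
      using measurable_sets[of \<phi> borel borel A] by simp
    have "emeasure (distr \<mu> borel \<phi>) A = emeasure \<mu> (\<phi> -` A)"
      by (simp add: emeasure_distr \<mu>_def)
    also have "\<dots> = (\<integral>\<^sup>+x. ennreal (indicator W x *\<^sub>R \<bar>det (D x)\<bar>) \<partial>lborel)"
      unfolding \<mu>_def by (subst emeasure_density) 
        (auto simp: W_def intro!: nn_integral_cong split: split_indicator)
    also have "\<dots> = ennreal (LINT x:W|lborel. \<bar>det (D x)\<bar>)"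
      unfolding set_lebesgue_integral_def using \<open>set_integrable lborel W (\<lambda>x. \<bar>det (D x)\<bar>)\<close>
      by (intro nn_integral_eq_integral) (auto simp: set_integrable_def)
    finally show "emeasure (distr \<mu> borel \<phi>) A = emeasure (density lborel (indicator V)) A"
      using 1 by (simp add: emeasure_density nn_integral_indicator' flip: indicator_inter_arith)
  qed simp
  then have "(\<integral>\<^sup>+y. F y \<partial>density lborel (indicator V)) = (\<integral>\<^sup>+y. F y \<partial>distr \<mu> borel \<phi>)"
    by simp
  also have "\<dots> = (\<integral>\<^sup>+x. F (\<phi> x) \<partial>\<mu>)"
    by (rule nn_integral_distr) (auto simp: \<mu>_def)
  also have "\<dots> = (\<integral>\<^sup>+x. indicator U x * ennreal \<bar>det (D x)\<bar> * F (\<phi> x) \<partial>lborel)"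
    unfolding \<mu>_def by (rule nn_integral_density) measurable
  finally show ?thesis
    by (simp add: nn_integral_density mult_ac)
qed

text \<open>By the inverse function theorem each regular point has a bounded neighbourhood on which \<open>\<phi>\<close> is a
  homeomorphism onto an open set and \<open>det D\<close> is bounded. By the Lindeloef property countably many
  of them suffice.\<close>
lemma regular_points_countable_cover:
  fixes \<phi> :: "real^'n \<Rightarrow> real^'n"
  assumes der: "\<And>x. (\<phi> has_derivative (\<lambda>v. D x *v v)) (at x)"
    and cont: "\<And>i j. continuous_on UNIV (\<lambda>x. D x $ i $ j)"
  obtains U V :: "nat \<Rightarrow> (real^'n) set" and g :: "nat \<Rightarrow> real^'n \<Rightarrow> real^'n" and B :: "nat \<Rightarrow> real"
  where "\<And>n. open (U n)" "\<And>n. open (V n)" "\<And>n. homeomorphism (U n) (V n) \<phi> (g n)"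
    "\<And>n. emeasure lborel (U n) < \<infinity>" "\<And>n x. x \<in> U n \<Longrightarrow> \<bar>det (D x)\<bar> \<le> B n"
    "{x. det (D x) \<noteq> 0} \<subseteq> (\<Union>n. U n)"
proof -
  have det_cont: "continuous_on UNIV (\<lambda>x. det (D x))"
    unfolding det_def by (intro continuous_intros cont)
  define D' where "D' x = Blinfun (\<lambda>v. D x *v v)" for x
  have D': "blinfun_apply (D' x) = (\<lambda>v. D x *v v)" for x
    unfolding D'_def by (intro bounded_linear_Blinfun_apply matrix_vector_mul_bounded_linear)
  have D'_cont: "continuous_on UNIV D'"
    by (rule continuous_on_blinfun_componentwise)
       (auto simp: D' matrix_vector_mult_def Basis_vec_def inner_axis continuous_on_vec_lambda
         intro!: continuous_intros cont)
  let ?nice = "\<lambda>U. open U \<and> (\<exists>V g B. open V \<and> homeomorphism U V \<phi> g \<and>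
      emeasure lborel U < \<infinity> \<and> (\<forall>x\<in>U. \<bar>det (D x)\<bar> \<le> B))"
  have nbhd: "\<exists>U. x \<in> U \<and> ?nice U" if x: "det (D x) \<noteq> 0" for x
  proof -
    obtain A' where A': "A' ** D x = mat 1"
      using x by (metis invertible_det_nz invertible_def)
    have "Blinfun ((*v) A') o\<^sub>L D' x = id_blinfun"
      by (intro blinfun_eqI)
         (simp add: D' bounded_linear_Blinfun_apply matrix_vector_mul_bounded_linear
            matrix_vector_mul_assoc A')
    then obtain U1 V1 g where UV: "open U1" "x \<in> U1" "open V1" "homeomorphism U1 V1 \<phi> g"
      using inverse_function_theorem[of UNIV \<phi> D' x] der D' D'_cont by (metis UNIV_I open_UNIV)
    define U where "U = U1 \<inter> ball x 1 \<inter> {y. \<bar>det (D y)\<bar> < \<bar>det (D x)\<bar> + 1}"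
    have "open {y. \<bar>det (D y)\<bar> < \<bar>det (D x)\<bar> + 1}"
      using det_cont by (intro open_Collect_less continuous_intros)
    then have "open U"
      using UV(1) by (auto simp: U_def)
    have sub: "U \<subseteq> U1"
      by (auto simp: U_def)
    have hom: "homeomorphism U (\<phi> ` U) \<phi> g"
      using UV(4) sub by (meson homeomorphism_of_subsets homeomorphism_def image_mono subset_refl order_trans)
    have "openin (top_of_set V1) (\<phi> ` U)"
      using homeomorphism_imp_open_map[OF UV(4), of U] \<open>open U\<close> sub open_openin_trans UV(1)
      by (simp add: open_subset)
    then have "open (\<phi> ` U)"
      using UV(3) openin_open_trans by blast
    moreover have "emeasure lborel U < \<infinity>"
      using \<open>open U\<close> emeasure_bounded_finite[of U] bounded_subset[OF bounded_ball, of U x 1]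
      by (auto simp: U_def)
    moreover have "x \<in> U"
      using UV by (auto simp: U_def)
    moreover have "\<forall>y\<in>U. \<bar>det (D y)\<bar> \<le> \<bar>det (D x)\<bar> + 1"
      by (auto simp: U_def)
    ultimately show ?thesis
      using \<open>open U\<close> hom by blast
  qed
  define \<F> where "\<F> = {U. ?nice U}"
  obtain \<F>' where \<F>': "\<F>' \<subseteq> \<F>" "countable \<F>'" "\<Union>\<F>' = \<Union>\<F>"
    using Lindelof[of \<F>] by (auto simp: \<F>_def)
  (* The empty set is admissible and makes the countable family nonempty, hence enumerable. *)
  have empty: "{} \<in> \<F>"
    by (auto simp: \<F>_def homeomorphism_def)
  define U where "U = from_nat_into (insert {} \<F>')"
  have rng: "range U = insert {} \<F>'"
    unfolding U_def using \<F>'(2) by (intro range_from_nat_into) auto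
  have "range U \<subseteq> \<F>"
    unfolding rng using \<F>'(1) empty by (rule insert_subsetI[rotated])
  then have "U n \<in> \<F>" for n
    by (rule subsetD) simp
  then have nice: "?nice (U n)" for n
    unfolding \<F>_def by (rule CollectD)
  have U: "open (U n)" "emeasure lborel (U n) < \<infinity>" for n
    using nice[of n] by (elim conjE exE; simp)+
  have ex: "\<exists>V g B. open V \<and> homeomorphism (U n) V \<phi> g \<and> (\<forall>x\<in>U n. \<bar>det (D x)\<bar> \<le> B)" for n
    using nice[of n] by (elim conjE exE) (intro exI conjI)
  obtain V where V: "\<forall>n. \<exists>g B. open (V n) \<and> homeomorphism (U n) (V n) \<phi> g \<and> (\<forall>x\<in>U n. \<bar>det (D x)\<bar> \<le> B)"
    using choice[OF allI[OF ex]] by (rule exE)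
  obtain g where g: "\<forall>n. \<exists>B. open (V n) \<and> homeomorphism (U n) (V n) \<phi> (g n) \<and> (\<forall>x\<in>U n. \<bar>det (D x)\<bar> \<le> B)"
    using choice[OF V] by (rule exE)
  obtain B where "\<forall>n. open (V n) \<and> homeomorphism (U n) (V n) \<phi> (g n) \<and> (\<forall>x\<in>U n. \<bar>det (D x)\<bar> \<le> B n)"
    using choice[OF g] by (rule exE)
  moreover have "{x. det (D x) \<noteq> 0} \<subseteq> (\<Union>n. U n)"
  proof
    fix x assume "x \<in> {x. det (D x) \<noteq> 0}"
    then have "det (D x) \<noteq> 0"
      by simp
    obtain A where A: "x \<in> A \<and> ?nice A"
      using nbhd[OF \<open>det (D x) \<noteq> 0\<close>] by (rule exE)
    have "A \<in> \<F>"
      unfolding \<F>_def by (rule CollectI) (rule conjunct2[OF A])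
    then have "x \<in> \<Union>\<F>'"
      unfolding \<F>'(3) using conjunct1[OF A] by (rule UnionI)
    then show "x \<in> (\<Union>n. U n)"
      unfolding rng by simp
  qed
  ultimately show ?thesis
    using U by (intro that[of U V g B]) simp_all
qed

text \<open>A fibre that meets each of countably many disjoint pieces in at most one point, given by \<open>e\<close>, is
  summed piece by piece.\<close>
lemma infsum_eq_suminf_pieces:
  fixes h :: "'a \<Rightarrow> ennreal"
  assumes disj: "disjoint_family W" and cover: "\<And>x. x \<in> A \<Longrightarrow> h x \<noteq> 0 \<Longrightarrow> \<exists>n. x \<in> W n"
    and piece: "\<And>n x. x \<in> A \<inter> W n \<Longrightarrow> x = e n"
  shows "(\<Sum>\<^sub>\<infinity>x\<in>A. h x) = (\<Sum>n. if e n \<in> A \<inter> W n then h (e n) else 0)"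
proof -
  let ?N = "{n. e n \<in> A \<inter> W n}"
  have inj: "inj_on e ?N"
    using disj by (intro inj_onI) (auto dest: disjoint_family_onD[of W UNIV])
  have "(\<Sum>\<^sub>\<infinity>x\<in>A. h x) = (\<Sum>\<^sub>\<infinity>x\<in>e ` ?N. h x)"
  proof (rule infsum_cong_neutral)
    show "h x = 0" if x: "x \<in> A - e ` ?N" for x
    proof (rule ccontr)
      assume "h x \<noteq> 0"
      then obtain n where "x \<in> A \<inter> W n"
        using cover x by blast
      with piece[of x n] x show False by auto
    qed
  qed auto
  also have "\<dots> = (\<Sum>\<^sub>\<infinity>n\<in>?N. h (e n))"
    using infsum_reindex[OF inj, of h] by (simp add: comp_def)
  also have "\<dots> = (\<Sum>\<^sub>\<infinity>n\<in>UNIV. if e n \<in> A \<inter> W n then h (e n) else 0)"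
    by (intro infsum_cong_neutral) auto
  also have "\<dots> = (\<Sum>n. if e n \<in> A \<inter> W n then h (e n) else 0)"
    by (intro sums_unique has_sum_imp_sums has_sum_infsum nonneg_summable_on_complete) simp
  finally show ?thesis .
qed

text \<open>The regular points are cut into countably many disjoint Borel pieces \<open>W n\<close>, each inside an open
  set on which \<open>\<phi>\<close> has a continuous inverse \<open>g n\<close>. Because \<open>h\<close> vanishes at critical points, the sum over
  a fibre is \<open>\<Sum>n. k n y\<close>, where \<open>k n y\<close> is \<open>h (g n y)\<close> if \<open>y\<close> comes from \<open>W n\<close>. This shows
  measurability, and the change of variables on every piece gives the formula.\<close>
theorem area_formula:
  fixes \<phi> :: "real^'n::{finite,wellorder} \<Rightarrow> real^'n::_" and h :: "real^'n::_ \<Rightarrow> ennreal"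
  assumes der: "\<And>x. (\<phi> has_derivative (\<lambda>v. D x *v v)) (at x)"
    and cont: "\<And>i j. continuous_on UNIV (\<lambda>x. D x $ i $ j)"
    and h [measurable]: "h \<in> borel_measurable borel" and h0: "\<And>x. det (D x) = 0 \<Longrightarrow> h x = 0"
  shows "(\<lambda>y. \<Sum>\<^sub>\<infinity>x\<in>{x. \<phi> x = y}. h x) \<in> borel_measurable borel"
    and "F \<in> borel_measurable borel \<Longrightarrow>
      (\<integral>\<^sup>+x. F (\<phi> x) * (h x * ennreal \<bar>det (D x)\<bar>) \<partial>lborel)
      = (\<integral>\<^sup>+y. F y * (\<Sum>\<^sub>\<infinity>x\<in>{x. \<phi> x = y}. h x) \<partial>lborel)"
proof -
  obtain U V :: "nat \<Rightarrow> (real^'n::_) set" and g :: "nat \<Rightarrow> real^'n::_ \<Rightarrow> real^'n::_" and B :: "nat \<Rightarrow> real"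
    where UV: "\<And>n. open (U n)" "\<And>n. open (V n)" "\<And>n. homeomorphism (U n) (V n) \<phi> (g n)"
    "\<And>n. emeasure lborel (U n) < \<infinity>" "\<And>n x. x \<in> U n \<Longrightarrow> \<bar>det (D x)\<bar> \<le> B n"
    and cover: "{x. det (D x) \<noteq> 0} \<subseteq> (\<Union>n. U n)"
  proof (rule regular_points_countable_cover[OF der cont])
    fix U V :: "nat \<Rightarrow> (real^'n::_) set" and g :: "nat \<Rightarrow> real^'n::_ \<Rightarrow> real^'n::_" and B :: "nat \<Rightarrow> real"
    assume "\<And>n. open (U n)" "\<And>n. open (V n)" "\<And>n. homeomorphism (U n) (V n) \<phi> (g n)"
      "\<And>n. emeasure lborel (U n) < \<infinity>" "\<And>n x. x \<in> U n \<Longrightarrow> \<bar>det (D x)\<bar> \<le> B n"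
      "{x. det (D x) \<noteq> 0} \<subseteq> (\<Union>n. U n)"
    then show thesis
      by (rule that[of U V g B])
  qed
  have "continuous_on UNIV (\<lambda>x. det (D x))"
    unfolding det_def by (intro continuous_intros cont)
  then have detm [measurable]: "(\<lambda>x. det (D x)) \<in> borel_measurable borel"
    by (rule borel_measurable_continuous_onI)
  have "continuous_on UNIV \<phi>"
    using der by (meson continuous_at_imp_continuous_on has_derivative_continuous)
  then have [measurable]: "\<phi> \<in> borel_measurable borel"
    by (simp add: borel_measurable_continuous_onI)
  define W where "W = disjointed U"
  have WU: "W n \<subseteq> U n" for n
    by (simp add: W_def disjointed_subset)
  have disj: "disjoint_family W"
    by (simp add: W_def disjoint_family_disjointed)
  have Wun: "(\<Union>n. W n) = (\<Union>n. U n)"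
    by (simp add: W_def UN_disjointed_eq)
  have [measurable]: "U n \<in> sets borel" "V n \<in> sets borel" for n
    using UV by auto
  have "range U \<subseteq> sets borel"
    by auto
  then have Wm [measurable]: "W n \<in> sets borel" for n
    unfolding W_def using sets.range_disjointed_sets[of U borel] by auto
  have g: "g n (\<phi> x) = x" "\<phi> x \<in> V n" if "x \<in> U n" for n x
    using that UV(3)[of n] by (auto simp: homeomorphism_def)
  have \<phi>g: "\<phi> (g n y) = y" "g n y \<in> U n" if "y \<in> V n" for n y
    using that UV(3)[of n] by (auto simp: homeomorphism_def)
  define k where "k n y = (if y \<in> V n then indicator (W n) (g n y) * h (g n y) else 0)" for n y
  have gm: "g n \<in> borel_measurable (restrict_space borel (V n))" for n
    using UV(3)[of n] by (intro borel_measurable_continuous_on_restrict) (auto simp: homeomorphism_def)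
  have km [measurable]: "k n \<in> borel_measurable borel" for n
  proof -
    have "(\<lambda>x. indicator (W n) x * h x) \<in> borel_measurable borel"
      by measurable
    from measurable_compose[OF gm this]
    have "(\<lambda>y. indicator (W n) (g n y) * h (g n y)) \<in> borel_measurable (restrict_space borel (V n))" .
    then show ?thesis
      unfolding k_def by (subst (asm) measurable_restrict_space_iff) (auto simp: )
  qed
  have fibre: "(\<Sum>\<^sub>\<infinity>x\<in>{x. \<phi> x = y}. h x) = (\<Sum>n. k n y)" for y
  proof -
    have "(\<Sum>\<^sub>\<infinity>x\<in>{x. \<phi> x = y}. h x)
        = (\<Sum>n. if g n y \<in> {x. \<phi> x = y} \<inter> W n then h (g n y) else 0)"
    proof (rule infsum_eq_suminf_pieces[OF disj])
      show "\<exists>n. x \<in> W n" if "h x \<noteq> 0" for x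
        using that h0 cover Wun by blast
      show "x = g n y" if "x \<in> {x. \<phi> x = y} \<inter> W n" for n x
        using that g WU by force
    qed
    also have "\<dots> = (\<Sum>n. k n y)"
    proof (intro suminf_cong)
      fix n
      have "y \<in> V n" if "\<phi> (g n y) = y" "g n y \<in> W n"
        using that g(2)[of "g n y" n] WU by auto
      then show "(if g n y \<in> {x. \<phi> x = y} \<inter> W n then h (g n y) else 0) = k n y"
        using \<phi>g[of y n] by (auto simp: k_def)
    qed
    finally show ?thesis .
  qed
  show "(\<lambda>y. \<Sum>\<^sub>\<infinity>x\<in>{x. \<phi> x = y}. h x) \<in> borel_measurable borel"
    unfolding fibre by measurable
  assume F [measurable]: "F \<in> borel_measurable borel"
  have piece: "(\<integral>\<^sup>+y. F y * k n y \<partial>lborel)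
      = (\<integral>\<^sup>+x. indicator (W n) x * (F (\<phi> x) * (h x * ennreal \<bar>det (D x)\<bar>)) \<partial>lborel)" for n
  proof -
    have "(\<integral>\<^sup>+y. F y * k n y \<partial>lborel) = (\<integral>\<^sup>+y. indicator (V n) y * (F y * k n y) \<partial>lborel)"
      by (intro nn_integral_cong) (auto simp: k_def)
    also have "\<dots> = (\<integral>\<^sup>+x. indicator (U n) x * (F (\<phi> x) * k n (\<phi> x) * ennreal \<bar>det (D x)\<bar>) \<partial>lborel)"
      by (rule nn_integral_image_diffeo[OF UV(1) UV(2) UV(3) der detm UV(4) UV(5)]) measurable
    also have "\<dots> = (\<integral>\<^sup>+x. indicator (W n) x * (F (\<phi> x) * (h x * ennreal \<bar>det (D x)\<bar>)) \<partial>lborel)"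
      using WU[of n] by (intro nn_integral_cong) (auto simp: k_def g mult_ac split: split_indicator)
    finally show ?thesis .
  qed
  have "(\<integral>\<^sup>+y. F y * (\<Sum>\<^sub>\<infinity>x\<in>{x. \<phi> x = y}. h x) \<partial>lborel) = (\<Sum>n. \<integral>\<^sup>+y. F y * k n y \<partial>lborel)"
    unfolding fibre by (simp add: nn_integral_suminf flip: ennreal_suminf_cmult)
  also have "\<dots> = (\<integral>\<^sup>+x. (\<Sum>n. indicator (W n) x * (F (\<phi> x) * (h x * ennreal \<bar>det (D x)\<bar>))) \<partial>lborel)"
    unfolding piece by (rule nn_integral_suminf[symmetric]) measurable
  also have "\<dots> = (\<integral>\<^sup>+x. F (\<phi> x) * (h x * ennreal \<bar>det (D x)\<bar>) \<partial>lborel)"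
  proof (intro nn_integral_cong)
    fix x
    have "(\<Sum>n. indicator (W n) x * (F (\<phi> x) * (h x * ennreal \<bar>det (D x)\<bar>)))
        = (\<Sum>n. indicator (W n) x) * (F (\<phi> x) * (h x * ennreal \<bar>det (D x)\<bar>))"
      by (rule ennreal_suminf_multc)
    also have "(\<Sum>n. indicator (W n) x :: ennreal) = indicator (\<Union>n. W n) x"
      by (rule suminf_indicator[OF disj])
    finally show "(\<Sum>n. indicator (W n) x * (F (\<phi> x) * (h x * ennreal \<bar>det (D x)\<bar>)))
        = F (\<phi> x) * (h x * ennreal \<bar>det (D x)\<bar>)"
      using cover h0[of x] Wun by (cases "x \<in> (\<Union>n. U n)") auto
  qed
  finally show "(\<integral>\<^sup>+x. F (\<phi> x) * (h x * ennreal \<bar>det (D x)\<bar>) \<partial>lborel)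
      = (\<integral>\<^sup>+y. F y * (\<Sum>\<^sub>\<infinity>x\<in>{x. \<phi> x = y}. h x) \<partial>lborel)" by simp
qed

section \<open>The area formula on a finite product\<close>

text \<open>The change of variables theorem requires a well-ordered index type. A copy of an arbitrary finite
  type can be well-ordered by some injection into the natural numbers.\<close>
typedef 'a wo = "UNIV :: 'a set" morphisms un_wo wo
  by simp

lemma wo_inverses [simp]: "un_wo (wo a) = a" "wo (un_wo i) = i"
  by (simp_all add: wo_inverse un_wo_inverse)

lemma inj_wo [simp]: "inj_on wo A" "wo a = wo b \<longleftrightarrow> a = b" "un_wo i = un_wo j \<longleftrightarrow> i = j"
  by (simp_all add: inj_on_def wo_inject un_wo_inject)

lemma range_wo [simp]: "range wo = UNIV"
  by (metis surj_def wo_inverses(2))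

lemma in_wo_image [simp]: "i \<in> wo ` S \<longleftrightarrow> un_wo i \<in> S"
  by (metis (no_types) image_iff wo_inverses)

instance wo :: (finite) finite
  by standard (metis finite finite_imageI range_wo)

instantiation wo :: (finite) wellorder
begin

definition wo_rank :: "'a wo \<Rightarrow> nat"
  where "wo_rank = (SOME f. inj f)"

definition less_eq_wo :: "'a wo \<Rightarrow> 'a wo \<Rightarrow> bool"
  where "less_eq_wo i j \<longleftrightarrow> wo_rank i \<le> wo_rank j"

definition less_wo :: "'a wo \<Rightarrow> 'a wo \<Rightarrow> bool"
  where "less_wo i j \<longleftrightarrow> wo_rank i < wo_rank j"

instance
proof
  obtain f :: "'a wo \<Rightarrow> nat" where "inj f"
    using finite_imp_inj_to_nat_seg[OF finite[of "UNIV :: 'a wo set"]] by (elim exE conjE)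
  then have "inj (wo_rank :: 'a wo \<Rightarrow> nat)"
    unfolding wo_rank_def by (rule someI[where P=inj])
  then show "i \<le> j \<Longrightarrow> j \<le> i \<Longrightarrow> i = j" for i j :: "'a wo"
    by (auto simp: less_eq_wo_def inj_def)
  show "P i" if step: "\<And>i. (\<And>j. j < i \<Longrightarrow> P j) \<Longrightarrow> P i" for P and i :: "'a wo"
    by (induction i rule: measure_induct_rule[of wo_rank]) (auto intro: step simp: less_wo_def)
qed (auto simp: less_eq_wo_def less_wo_def)

end

lemma sum_wo: "(\<Sum>i\<in>UNIV. f i) = (\<Sum>a\<in>UNIV. f (wo a))"
  using sum.reindex[OF inj_wo(1), of f UNIV] by simp

lemma prod_wo: "(\<Prod>i\<in>UNIV. f i) = (\<Prod>a\<in>UNIV. f (wo a))"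
  using prod.reindex[OF inj_wo(1), of f UNIV] by simp

text \<open>Conjugating a permutation with a bijection preserves its sign.\<close>
lemma det_on_reindex:
  assumes "finite S" "inj_on f S"
  shows "det_on (f ` S) M = det_on S (\<lambda>c d. M (f c) (f d))"
proof -
  have bij: "bij_betw f S (f ` S)"
    using assms by (simp add: bij_betw_def)
  let ?m = "\<lambda>\<pi> x. if x \<in> f ` S then f (\<pi> (inv_into S f x)) else x"
  have m: "?m \<pi> = map_permutation S f \<pi>" for \<pi>
    by (auto simp: map_permutation_def restrict_id_def fun_eq_iff)
  show ?thesis
    unfolding det_on_def sum.reindex_bij_betw[OF bij_betw_permutations[OF bij], symmetric]
  proof (intro sum.cong refl)
    fix \<pi> assume "\<pi> \<in> {\<pi>. \<pi> permutes S}"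
    then have \<pi>: "\<pi> permutes S" by simp
    show "of_int (sign (?m \<pi>)) * (\<Prod>c\<in>f ` S. M c (?m \<pi> c))
        = of_int (sign \<pi>) * (\<Prod>c\<in>S. M (f c) (f (\<pi> c)))"
      using assms(2) by (subst prod.reindex) 
        (simp_all add: m sign_map_permutation[OF assms(2) \<pi> assms(1)] map_permutation_apply)
  qed
qed

lemma axis_Basis: "(Basis :: (real^'n) set) = range (\<lambda>i. axis i 1)"
  by (auto simp: Basis_vec_def)

lemma emeasure_lborel_cart_box:
  fixes B :: "'n::finite \<Rightarrow> real set"
  assumes "\<And>i. B i \<in> sets borel"
  shows "emeasure lborel {x :: real^'n. \<forall>i. x $ i \<in> B i} = (\<Prod>i\<in>UNIV. emeasure lborel (B i))"
    and "{x :: real^'n. \<forall>i. x $ i \<in> B i} \<in> sets borel"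
proof -
  have inj: "inj (\<lambda>i. axis i 1 :: real^'n)"
    by (simp add: inj_def axis_eq_axis)
  have [measurable]: "B i \<in> sets borel" for i
    by (rule assms)
  have "(\<lambda>x. x $ i) \<in> borel_measurable borel" for i :: 'n
    by (intro borel_measurable_continuous_onI continuous_intros)
  then show m [measurable]: "{x :: real^'n. \<forall>i. x $ i \<in> B i} \<in> sets borel"
    by measurable
  have prod: "(\<Prod>b\<in>(Basis :: (real^'n) set). f b) = (\<Prod>i\<in>UNIV. f (axis i 1))" for f :: "real^'n \<Rightarrow> ennreal"
    unfolding axis_Basis prod.reindex[OF inj] by simp
  have ind: "indicator {x :: real^'n. \<forall>i. x $ i \<in> B i} x
      = (\<Prod>b\<in>Basis. indicator (B (axis_index b)) (x \<bullet> b) :: ennreal)" for x :: "real^'n"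
    unfolding prod by (auto simp: inner_axis indicator_def prod_zero_iff)
  have "emeasure lborel {x :: real^'n. \<forall>i. x $ i \<in> B i}
      = (\<integral>\<^sup>+x. indicator {x :: real^'n. \<forall>i. x $ i \<in> B i} x \<partial>lborel)"
    by simp
  also have "\<dots> = (\<Prod>b\<in>(Basis :: (real^'n) set). \<integral>\<^sup>+t. indicator (B (axis_index b)) t \<partial>lborel)"
    unfolding ind by (rule nn_integral_lborel_prod) auto
  finally show "emeasure lborel {x :: real^'n. \<forall>i. x $ i \<in> B i} = (\<Prod>i\<in>UNIV. emeasure lborel (B i))"
    unfolding prod by simp
qed

definition coords :: "real^('a::finite wo) \<Rightarrow> 'a \<Rightarrow> real"
  where "coords x a = x $ wo a"

text \<open>The index set \<open>S\<close> is a subset of a type, so \<open>real^('a wo)\<close> has the additional coordinates outside \<open>S\<close>.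
  Confining them to the unit interval gives them total mass \<open>1\<close>, whence integrating over the slab is
  the same as integrating over \<open>\<Pi>\<^sub>M d\<in>S. lborel\<close>.\<close>
definition unit_slab :: "'a::finite set \<Rightarrow> (real^('a wo)) set"
  where "unit_slab S = {x. \<forall>a. a \<notin> S \<longrightarrow> coords x a \<in> {0..1}}"

lemma coords_measurable [measurable]: "(\<lambda>x :: real^('a::finite wo). coords x a) \<in> borel_measurable borel"
  unfolding coords_def by (intro borel_measurable_continuous_onI continuous_intros)

lemma unit_slab_borel [measurable]: "unit_slab S \<in> sets (borel :: (real^('a::finite wo)) measure)"
  unfolding unit_slab_def by measurable

lemma restrict_coords_measurable [measurable]:
  "(\<lambda>x. restrict (coords x) S) \<in> borel \<rightarrow>\<^sub>M (\<Pi>\<^sub>M d\<in>S. (lborel :: real measure))"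
    for S :: "'a::finite set"
  by (intro measurable_restrict) simp

lemma distr_unit_slab:
  fixes S :: "'a::finite set"
  shows "distr (density lborel (indicator (unit_slab S))) (\<Pi>\<^sub>M d\<in>S. lborel) (\<lambda>x. restrict (coords x) S)
    = (\<Pi>\<^sub>M d\<in>S. lborel)"
proof -
  interpret product_sigma_finite "\<lambda>_ :: 'a. lborel :: real measure" ..
  show ?thesis
  proof (rule PiM_eqI)
    fix A :: "'a \<Rightarrow> real set" assume A: "\<And>i. i \<in> S \<Longrightarrow> A i \<in> sets lborel"
    define B where "B i = (if un_wo i \<in> S then A (un_wo i) else {0..1})" for i
    have B: "B i \<in> sets borel" for i
      using A by (auto simp: B_def)
    have PA: "Pi\<^sub>E S A \<in> sets (\<Pi>\<^sub>M d\<in>S. lborel)"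
      using A by (intro sets_PiM_I_finite) auto
    have eq: "indicator (unit_slab S) x * indicator ((\<lambda>x. restrict (coords x) S) -` Pi\<^sub>E S A) x
        = (indicator {x. \<forall>i. x $ i \<in> B i} x :: ennreal)" for x
    proof -
      have "(\<forall>i. x $ i \<in> B i) \<longleftrightarrow> (\<forall>a. coords x a \<in> B (wo a))"
        unfolding coords_def by (metis wo_inverses(2))
      then show ?thesis
        by (auto simp: unit_slab_def B_def indicator_def split: if_splits)
    qed
    have "(\<lambda>x. restrict (coords x) S) -` Pi\<^sub>E S A \<in> sets borel"
      using measurable_sets[OF restrict_coords_measurable PA] by simp
    then have "emeasure (distr (density lborel (indicator (unit_slab S))) (\<Pi>\<^sub>M d\<in>S. lborel) (\<lambda>x. restrict (coords x) S))
        (Pi\<^sub>E S A) = (\<integral>\<^sup>+x. indicator {x. \<forall>i. x $ i \<in> B i} x \<partial>lborel)"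
      using PA by (subst emeasure_distr) (simp_all add: emeasure_density eq)
    also have "\<dots> = (\<Prod>a\<in>UNIV. emeasure lborel (B (wo a)))"
      using B by (simp add: emeasure_lborel_cart_box prod_wo)
    also have "\<dots> = (\<Prod>a\<in>S. emeasure lborel (A a))"
      by (intro prod.mono_neutral_cong_right) (auto simp: B_def)
    finally show "emeasure (distr (density lborel (indicator (unit_slab S))) (\<Pi>\<^sub>M d\<in>S. lborel)
        (\<lambda>x. restrict (coords x) S)) (Pi\<^sub>E S A) = (\<Prod>a\<in>S. emeasure lborel (A a))" .
  qed simp_all
qed

lemma nn_integral_unit_slab:
  fixes S :: "'a::finite set"
  assumes [measurable]: "f \<in> borel_measurable (\<Pi>\<^sub>M d\<in>S. lborel)"
  shows "(\<integral>\<^sup>+\<theta>. f \<theta> \<partial>(\<Pi>\<^sub>M d\<in>S. lborel))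
    = (\<integral>\<^sup>+x. indicator (unit_slab S) x * f (restrict (coords x) S) \<partial>lborel)"
proof -
  have "(\<integral>\<^sup>+\<theta>. f \<theta> \<partial>(\<Pi>\<^sub>M d\<in>S. lborel)) = (\<integral>\<^sup>+\<theta>. f \<theta> \<partial>(distr (density lborel (indicator (unit_slab S)))
      (\<Pi>\<^sub>M d\<in>S. lborel) (\<lambda>x. restrict (coords x) S)))"
    by (simp only: distr_unit_slab)
  also have "\<dots> = (\<integral>\<^sup>+x. f (restrict (coords x) S) \<partial>density lborel (indicator (unit_slab S)))"
    by (rule nn_integral_distr) auto
  also have "\<dots> = (\<integral>\<^sup>+x. indicator (unit_slab S) x * f (restrict (coords x) S) \<partial>lborel)"
    by (rule nn_integral_density) measurable
  finally show ?thesis .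
qed

text \<open>The map \<open>p\<close> is extended to \<open>real^('a wo)\<close> by the identity on the coordinates outside \<open>S\<close>. The extension
  \<open>\<phi>\<close> maps the unit slab to itself and has the same Jacobian, and its fibre over a point of the slab
  corresponds to the fibre of \<open>p\<close>. So the area formula for \<open>\<phi>\<close> with the integrand restricted to the
  slab is the area formula for \<open>p\<close>. The hypothesis \<open>h0\<close> keeps critical points out of the fibre sums.\<close>
theorem area_formula_PiM:
  fixes S :: "'a::finite set" and p :: "('a \<Rightarrow> real) \<Rightarrow> 'a \<Rightarrow> real"
    and J :: "('a \<Rightarrow> real) \<Rightarrow> 'a \<Rightarrow> 'a \<Rightarrow> real" and h :: "('a \<Rightarrow> real) \<Rightarrow> ennreal"
  defines "M \<equiv> \<Pi>\<^sub>M d\<in>S. (lborel :: real measure)"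
  assumes p: "\<And>\<theta>. p \<theta> \<in> extensional S" "\<And>\<theta>. p (restrict \<theta> S) = p \<theta>"
    and J: "\<And>\<theta> c d. J (restrict \<theta> S) c d = J \<theta> c d"
    and der: "\<And>c x. c \<in> S \<Longrightarrow>
      ((\<lambda>x :: real^'a. p (($) x) c) has_derivative (\<lambda>v. \<Sum>d\<in>S. J (($) x) c d * v $ d)) (at x)"
    and cont: "\<And>c d. c \<in> S \<Longrightarrow> d \<in> S \<Longrightarrow> continuous_on UNIV (\<lambda>x :: real^'a. J (($) x) c d)"
    and h [measurable]: "h \<in> borel_measurable M" and h0: "\<And>\<theta>. det_on S (J \<theta>) = 0 \<Longrightarrow> h \<theta> = 0"
  shows "(\<lambda>y. \<Sum>\<^sub>\<infinity>\<theta>\<in>{\<theta>\<in>space M. p \<theta> = y}. h \<theta>) \<in> borel_measurable M"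
    and "distr (density M (\<lambda>\<theta>. h \<theta> * ennreal \<bar>det_on S (J \<theta>)\<bar>)) M p
      = density M (\<lambda>y. \<Sum>\<^sub>\<infinity>\<theta>\<in>{\<theta>\<in>space M. p \<theta> = y}. h \<theta>)"
proof -
  define T where "T x = restrict (coords x) S" for x :: "real^('a wo)"
  define E where "E \<theta> = (\<chi> i. if un_wo i \<in> S then \<theta> (un_wo i) else (0 :: real))" for \<theta>
  define \<phi> where "\<phi> x = (\<chi> i. if un_wo i \<in> S then p (coords x) (un_wo i) else x $ i)" for x
  define D where "D x = (\<chi> i j. if un_wo i \<in> S then of_bool (un_wo j \<in> S) * J (coords x) (un_wo i) (un_wo j)
      else of_bool (i = j))" for x
  define H where "H y = (\<Sum>\<^sub>\<infinity>\<theta>\<in>{\<theta>\<in>space M. p \<theta> = y}. h \<theta>)" for y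
  define Q where "Q = unit_slab S"
  define h' where "h' x = indicator Q x * h (T x)" for x
  have space: "space M = extensional S"
    by (simp add: M_def space_PiM PiE_def)
  have T [measurable]: "T \<in> borel \<rightarrow>\<^sub>M M"
    unfolding T_def M_def by measurable
  have [measurable]: "Q \<in> sets borel"
    by (simp add: Q_def)
  have E [measurable]: "E \<in> M \<rightarrow>\<^sub>M borel"
  proof -
    have "(\<lambda>\<theta>. if a \<in> S then \<theta> a else 0) \<in> borel_measurable M" for a
      unfolding M_def by (cases "a \<in> S") auto
    then show ?thesis
      by (subst borel_measurable_euclidean_space) (auto simp: axis_Basis inner_axis E_def)
  qed
  have TE: "T (E \<theta>) = \<theta>" "E \<theta> \<in> Q" if "\<theta> \<in> space M" for \<theta>
    using that by (auto simp: T_def E_def Q_def unit_slab_def coords_def space extensional_def fun_eq_iff)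
  have pT: "p (T x) = p (coords x)" and JT: "J (T x) = J (coords x)" for x
    by (auto simp: T_def p J fun_eq_iff)
  have T\<phi>: "T (\<phi> x) = p (T x)" for x
    using p(1)[of "coords x"] by (auto simp: T_def \<phi>_def coords_def pT[unfolded T_def] fun_eq_iff extensional_def)
  have T_space: "T x \<in> space M" for x
    by (auto simp: T_def space)
  define lin where "lin x = (\<chi> a. x $ wo a)" for x :: "real^('a wo)"
  have lin: "bounded_linear lin"
    unfolding lin_def by (intro linear_conv_bounded_linear[THEN iffD1] linearI) (auto simp: vec_eq_iff)
  have lin_coords: "($) (lin x) = coords x" for x
    by (auto simp: lin_def coords_def fun_eq_iff)
  have comp: "((\<lambda>x. p (coords x) c) has_derivative (\<lambda>v. \<Sum>d\<in>S. J (coords x) c d * v $ wo d)) (at x)"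
    if "c \<in> S" for c x
    using has_derivative_compose[OF bounded_linear_imp_has_derivative[OF lin, of "at x"] der[OF that, of "lin x"]]
    unfolding lin_coords by (simp add: coords_def)
  have der\<phi>: "(\<phi> has_derivative (\<lambda>v. D x *v v)) (at x)" for x
  proof -
    have "((\<lambda>x. \<phi> x $ i) has_derivative (\<lambda>v. (D x *v v) $ i)) (at x)" for i
    proof (cases "un_wo i \<in> S")
      case True
      have "(D x *v v) $ i = (\<Sum>d\<in>S. J (coords x) (un_wo i) d * v $ wo d)" for v
      proof -
        have "(D x *v v) $ i = (\<Sum>a\<in>UNIV. of_bool (a \<in> S) * J (coords x) (un_wo i) a * v $ wo a)"
          using True by (simp add: matrix_vector_mult_def D_def sum_wo)
        also have "\<dots> = (\<Sum>d\<in>S. J (coords x) (un_wo i) d * v $ wo d)"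
          by (intro sum.mono_neutral_cong_right) auto
        finally show ?thesis .
      qed
      then show ?thesis
        using comp[OF True, of x] True by (simp add: \<phi>_def)
    next
      case False
      have "(D x *v v) $ i = v $ i" for v
      proof -
        have "(D x *v v) $ i = (\<Sum>j\<in>UNIV. if j = i then v $ j else 0)"
          unfolding matrix_vector_mult_def vec_lambda_beta
          using False by (intro sum.cong) (auto simp: D_def)
        then show ?thesis by simp
      qed
      then show ?thesis
        using False bounded_linear_imp_has_derivative[OF bounded_linear_vec_nth, of i "at x"] by (simp add: \<phi>_def)
    qed
    then show ?thesis
      by (subst has_derivative_componentwise_within) (auto simp: axis_Basis inner_axis)
  qed
  have contD: "continuous_on UNIV (\<lambda>x. D x $ i $ j)" for i j
  proof (cases "un_wo i \<in> S \<and> un_wo j \<in> S")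
    case True
    have "continuous_on UNIV lin"
      using lin by (rule linear_continuous_on)
    then have "continuous_on UNIV (\<lambda>x. J (($) (lin x)) (un_wo i) (un_wo j))"
      using True by (intro continuous_on_compose2[OF cont]) auto
    then show ?thesis
      using True by (simp add: D_def lin_coords)
  qed (cases "un_wo i \<in> S"; auto simp: D_def)
  have detD: "det (D x) = det_on S (J (T x))" for x
  proof -
    have "det (D x) = det_on (wo ` S) (\<lambda>i j. if un_wo i \<in> S then of_bool (un_wo j \<in> S) * J (coords x) (un_wo i) (un_wo j)
      else of_bool (i = j))"
      unfolding D_def by (rule det_on_eq_det[symmetric]) auto
    also have "\<dots> = det_on S (\<lambda>c d. if c \<in> S then of_bool (d \<in> S) * J (coords x) c d else of_bool (c = d))"
      by (subst det_on_reindex) (simp_all cong: if_cong)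
    also have "\<dots> = det_on S (J (T x))"
      unfolding det_on_def
      by (intro sum.cong prod.cong arg_cong2[where f="(*)"] refl) (auto simp: JT permutes_in_image)
    finally show ?thesis .
  qed
  have h'm [measurable]: "h' \<in> borel_measurable borel"
    unfolding h'_def by measurable
  have h'0: "h' x = 0" if "det (D x) = 0" for x
    using that h0 by (simp add: h'_def detD)
  have "continuous_on UNIV (\<lambda>x. det (D x))"
    unfolding det_def by (intro continuous_intros contD)
  then have detm: "(\<lambda>x. det (D x)) \<in> borel_measurable borel"
    by (rule borel_measurable_continuous_onI)
  have detM [measurable]: "(\<lambda>\<theta>. det_on S (J \<theta>)) \<in> borel_measurable M"
    by (rule measurable_cong[THEN iffD1, OF _ measurable_compose[OF E detm]]) (simp add: detD TE)
  have "continuous_on UNIV \<phi>"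
    using der\<phi> by (meson continuous_at_imp_continuous_on has_derivative_continuous)
  then have \<phi>m: "\<phi> \<in> borel_measurable borel"
    by (rule borel_measurable_continuous_onI)
  have pm [measurable]: "p \<in> M \<rightarrow>\<^sub>M M"
    by (rule measurable_cong[THEN iffD1, OF _ measurable_compose[OF measurable_compose[OF E \<phi>m] T]])
       (simp add: T\<phi> TE)
  have fibre: "(\<Sum>\<^sub>\<infinity>x\<in>{x. \<phi> x = y}. h' x) = indicator Q y * H (T y)" for y
  proof (cases "y \<in> Q")
    case True
    have dummy: "x $ i = y $ i" if "\<phi> x = y" "un_wo i \<notin> S" for x i
      using that by (auto simp: \<phi>_def)
    have inQ: "x \<in> Q" if "\<phi> x = y" for x
      using True dummy[OF that] by (auto simp: Q_def unit_slab_def coords_def)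
    let ?e = "\<lambda>\<theta>. \<chi> i. if un_wo i \<in> S then \<theta> (un_wo i) else y $ i"
    have Te: "T (?e \<theta>) = \<theta>" if "\<theta> \<in> space M" for \<theta>
      using that by (auto simp: T_def coords_def space extensional_def fun_eq_iff)
    have "(\<Sum>\<^sub>\<infinity>x\<in>{x. \<phi> x = y}. h' x) = H (T y)"
      unfolding H_def
    proof (rule infsum_reindex_bij_witness[where j=T and i="?e"])
      fix x assume "x \<in> {x. \<phi> x = y}"
      then have x: "\<phi> x = y" by simp
      show "?e (T x) = x"
        using dummy[OF x] by (auto simp: vec_eq_iff T_def coords_def)
      show "T x \<in> {\<theta>\<in>space M. p \<theta> = T y}"
        using T_space T\<phi>[of x] x by simp
      show "h (T x) = h' x"
        using inQ[OF x] by (simp add: h'_def)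
    next
      fix \<theta> assume \<theta>: "\<theta> \<in> {\<theta>\<in>space M. p \<theta> = T y}"
      then show "T (?e \<theta>) = \<theta>" using Te by simp
      have "p (coords (?e \<theta>)) = T y"
        using \<theta> Te[of \<theta>] by (simp flip: pT)
      then show "?e \<theta> \<in> {x. \<phi> x = y}"
        by (auto simp: \<phi>_def vec_eq_iff T_def coords_def)
    qed
    then show ?thesis
      using True by simp
  next
    case False
    have "x \<notin> Q" if "\<phi> x = y" for x
      using False that by (auto simp: Q_def unit_slab_def coords_def \<phi>_def)
    then have "(\<Sum>\<^sub>\<infinity>x\<in>{x. \<phi> x = y}. h' x) = 0"
      by (intro infsum_0) (auto simp: h'_def)
    then show ?thesis
      using False by simp
  qed
  have H'm [measurable]: "(\<lambda>y. \<Sum>\<^sub>\<infinity>x\<in>{x. \<phi> x = y}. h' x) \<in> borel_measurable borel"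
    by (rule area_formula(1)[OF der\<phi> contD h'm h'0])
  have "(\<lambda>\<theta>. \<Sum>\<^sub>\<infinity>x\<in>{x. \<phi> x = E \<theta>}. h' x) \<in> borel_measurable M"
    using measurable_compose[OF E H'm] .
  then have Hm [measurable]: "H \<in> borel_measurable M"
    by (rule measurable_cong[THEN iffD1, rotated]) (simp add: fibre TE)
  then show "(\<lambda>y. \<Sum>\<^sub>\<infinity>\<theta>\<in>{\<theta>\<in>space M. p \<theta> = y}. h \<theta>) \<in> borel_measurable M"
    unfolding H_def[abs_def] .
  have "distr (density M (\<lambda>\<theta>. h \<theta> * ennreal \<bar>det_on S (J \<theta>)\<bar>)) M p = density M H"
  proof (rule measure_eqI)
    fix A assume "A \<in> sets (distr (density M (\<lambda>\<theta>. h \<theta> * ennreal \<bar>det_on S (J \<theta>)\<bar>)) M p)"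
    then have A [measurable]: "A \<in> sets M" by simp
    have "emeasure (distr (density M (\<lambda>\<theta>. h \<theta> * ennreal \<bar>det_on S (J \<theta>)\<bar>)) M p) A
        = (\<integral>\<^sup>+\<theta>. h \<theta> * ennreal \<bar>det_on S (J \<theta>)\<bar> * indicator A (p \<theta>) \<partial>M)"
      using measurable_sets[OF pm A]
      by (simp add: emeasure_distr emeasure_density)
         (auto intro!: nn_integral_cong simp: indicator_def)
    also have "\<dots> = (\<integral>\<^sup>+x. indicator Q x * (h (T x) * ennreal \<bar>det_on S (J (T x))\<bar> * indicator A (p (T x))) \<partial>lborel)"
      unfolding M_def Q_def T_def by (rule nn_integral_unit_slab) (simp flip: M_def)
    also have "\<dots> = (\<integral>\<^sup>+x. indicator A (T (\<phi> x)) * (h' x * ennreal \<bar>det (D x)\<bar>) \<partial>lborel)"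
      by (simp add: h'_def detD T\<phi> mult_ac)
    also have "\<dots> = (\<integral>\<^sup>+y. indicator A (T y) * (\<Sum>\<^sub>\<infinity>x\<in>{x. \<phi> x = y}. h' x) \<partial>lborel)"
      by (rule area_formula(2)[OF der\<phi> contD h'm h'0]) measurable
    also have "\<dots> = (\<integral>\<^sup>+y. indicator Q y * (H (T y) * indicator A (T y)) \<partial>lborel)"
      by (simp add: fibre mult_ac)
    also have "\<dots> = (\<integral>\<^sup>+\<theta>. H \<theta> * indicator A \<theta> \<partial>M)"
      unfolding M_def Q_def T_def by (rule nn_integral_unit_slab[symmetric]) (simp flip: M_def)
    also have "\<dots> = emeasure (density M H) A"
      by (simp add: emeasure_density)
    finally show "emeasure (distr (density M (\<lambda>\<theta>. h \<theta> * ennreal \<bar>det_on S (J \<theta>)\<bar>)) M p) A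
        = emeasure (density M H) A" .
  qed simp
  then show "distr (density M (\<lambda>\<theta>. h \<theta> * ennreal \<bar>det_on S (J \<theta>)\<bar>)) M p
      = density M (\<lambda>y. \<Sum>\<^sub>\<infinity>\<theta>\<in>{\<theta>\<in>space M. p \<theta> = y}. h \<theta>)"
    unfolding H_def[abs_def] .
qed

section \<open>The critical set\<close>

text \<open>Induction on the variables. As a function of the last variable \<open>t\<close> the sum is \<open>A + exp t * B\<close>. The
  coefficient \<open>A\<close> has the same constant term, so by induction it is almost everywhere nonzero, and then
  at most one \<open>t\<close> makes the sum vanish. Fubini finishes the proof.\<close>
lemma AE_exp_polynomial_nonzero:
  fixes T :: "'k \<Rightarrow> 'a set" and w :: "'k \<Rightarrow> real"
  assumes "finite S" "finite K" "\<And>k. k \<in> K \<Longrightarrow> T k \<subseteq> S" "(\<Sum>k\<in>{k\<in>K. T k = {}}. w k) \<noteq> 0"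
  shows "AE \<theta> in (\<Pi>\<^sub>M d\<in>S. (lborel :: real measure)). (\<Sum>k\<in>K. w k * exp (\<Sum>d\<in>T k. \<theta> d)) \<noteq> 0"
  using assms
proof (induction S arbitrary: K rule: finite_induct)
  case empty
  have "{k \<in> K. T k = {}} = K"
    using empty.prems by auto
  then have "(\<Sum>k\<in>K. w k * exp (\<Sum>d\<in>T k. \<theta> d)) \<noteq> 0" for \<theta> :: "'a \<Rightarrow> real"
    using empty.prems by (auto intro: sum.cong)
  then show ?case by simp
next
  case (insert d S)
  interpret product_sigma_finite "\<lambda>_ :: 'a. lborel :: real measure" ..
  let ?M = "\<lambda>S. \<Pi>\<^sub>M d\<in>S. (lborel :: real measure)"
  define f where "f \<theta> = (\<Sum>k\<in>K. w k * exp (\<Sum>d\<in>T k. \<theta> d))" for \<theta>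
  define A where "A \<theta> = (\<Sum>k\<in>{k\<in>K. d \<notin> T k}. w k * exp (\<Sum>d\<in>T k. \<theta> d))" for \<theta>
  define B where "B \<theta> = (\<Sum>k\<in>{k\<in>K. d \<in> T k}. w k * exp (\<Sum>d\<in>T k - {d}. \<theta> d))" for \<theta>
  have comp: "(\<lambda>\<theta>. \<theta> e) \<in> borel_measurable (?M (insert d S))" if "e \<in> insert d S" for e
    using measurable_component_singleton[OF that, of "\<lambda>_. lborel :: real measure"] by simp
  have "(\<lambda>\<theta>. \<Sum>e\<in>T k. \<theta> e) \<in> borel_measurable (?M (insert d S))" if "k \<in> K" for k
    using insert.prems(2)[OF that] by (intro borel_measurable_sum comp) blast
  then have "(\<lambda>\<theta>. w k * exp (\<Sum>e\<in>T k. \<theta> e)) \<in> borel_measurable (?M (insert d S))" if "k \<in> K" for k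
    using that by measurable
  then have fm [measurable]: "f \<in> borel_measurable (?M (insert d S))"
    unfolding f_def[abs_def] by (rule borel_measurable_sum)
  have split: "f (\<theta>(d := t)) = A \<theta> + exp t * B \<theta>" for \<theta> t
  proof -
    have "f (\<theta>(d := t)) = (\<Sum>k\<in>{k\<in>K. d \<notin> T k} \<union> {k\<in>K. d \<in> T k}. w k * exp (\<Sum>e\<in>T k. (\<theta>(d := t)) e))"
      unfolding f_def by (intro sum.cong) auto
    also have "\<dots> = (\<Sum>k\<in>{k\<in>K. d \<notin> T k}. w k * exp (\<Sum>e\<in>T k. (\<theta>(d := t)) e))
        + (\<Sum>k\<in>{k\<in>K. d \<in> T k}. w k * exp (\<Sum>e\<in>T k. (\<theta>(d := t)) e))"
      using insert.prems(1) by (intro sum.union_disjoint) auto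
    also have "(\<Sum>k\<in>{k\<in>K. d \<notin> T k}. w k * exp (\<Sum>e\<in>T k. (\<theta>(d := t)) e)) = A \<theta>"
      unfolding A_def
    proof (intro sum.cong refl)
      fix k assume "k \<in> {k \<in> K. d \<notin> T k}"
      then have "(\<theta>(d := t)) e = \<theta> e" if "e \<in> T k" for e
        using that by (intro fun_upd_other) blast
      then have "(\<Sum>e\<in>T k. (\<theta>(d := t)) e) = (\<Sum>e\<in>T k. \<theta> e)"
        by (rule sum.cong[OF refl])
      then show "w k * exp (\<Sum>e\<in>T k. (\<theta>(d := t)) e) = w k * exp (\<Sum>e\<in>T k. \<theta> e)"
        by (simp only:)
    qed
    also have "(\<Sum>k\<in>{k\<in>K. d \<in> T k}. w k * exp (\<Sum>e\<in>T k. (\<theta>(d := t)) e)) = exp t * B \<theta>"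
      unfolding B_def sum_distrib_left
    proof (intro sum.cong refl)
      fix k assume k: "k \<in> {k \<in> K. d \<in> T k}"
      then have "finite (T k)"
        using insert.prems(2)[of k] insert.hyps(1) finite_subset[of "T k" "insert d S"] by simp
      then have "(\<Sum>e\<in>T k. (\<theta>(d := t)) e) = t + (\<Sum>e\<in>T k - {d}. (\<theta>(d := t)) e)"
        using k by (subst sum.remove[of _ d]) auto
      also have "(\<Sum>e\<in>T k - {d}. (\<theta>(d := t)) e) = (\<Sum>e\<in>T k - {d}. \<theta> e)"
        by (intro sum.cong refl fun_upd_other) blast
      finally show "w k * exp (\<Sum>e\<in>T k. (\<theta>(d := t)) e) = exp t * (w k * exp (\<Sum>e\<in>T k - {d}. \<theta> e))"
        by (simp only: exp_add mult_ac)
    qed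
    finally show ?thesis .
  qed
  have "{k \<in> {k \<in> K. d \<notin> T k}. T k = {}} = {k \<in> K. T k = {}}"
    by auto
  then have A: "AE \<theta> in ?M S. A \<theta> \<noteq> 0"
    unfolding A_def using insert.prems by (intro insert.IH) auto
  have slice: "(\<integral>\<^sup>+t. indicator {\<theta>. f \<theta> = 0} (\<theta>(d := t)) \<partial>lborel) = 0" if "A \<theta> \<noteq> 0" for \<theta>
  proof -
    have "{t. f (\<theta>(d := t)) = 0} \<subseteq> {ln (- A \<theta> / B \<theta>)}"
    proof
      fix t assume "t \<in> {t. f (\<theta>(d := t)) = 0}"
      then have eq: "A \<theta> + exp t * B \<theta> = 0"
        by (simp add: split)
      then have "B \<theta> \<noteq> 0"
        using that by auto
      then have "exp t = - A \<theta> / B \<theta>"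
        using eq by (simp add: field_simps)
      then show "t \<in> {ln (- A \<theta> / B \<theta>)}"
        by (metis ln_exp singletonI)
    qed
    then have "{t. f (\<theta>(d := t)) = 0} \<in> null_sets lborel"
      by (meson finite.intros finite_imp_null_set_lborel finite_subset)
    moreover have "indicator {\<theta>. f \<theta> = 0} (\<theta>(d := t)) = (indicator {t. f (\<theta>(d := t)) = 0} t :: ennreal)" for t
      by (simp add: indicator_def)
    ultimately show ?thesis
      by (simp add: null_sets_def)
  qed
  have ind: "indicator {\<theta>. f \<theta> = 0} \<in> borel_measurable (?M (insert d S))"
    by measurable
  have "(\<integral>\<^sup>+\<theta>. indicator {\<theta>. f \<theta> = 0} \<theta> \<partial>?M (insert d S))
      = (\<integral>\<^sup>+\<theta>. \<integral>\<^sup>+t. indicator {\<theta>. f \<theta> = 0} (\<theta>(d := t)) \<partial>lborel \<partial>?M S)"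
    using product_nn_integral_insert[OF insert.hyps(1,2) ind] .
  also have "\<dots> = (\<integral>\<^sup>+\<theta>. 0 \<partial>?M S)"
    using A slice by (intro nn_integral_cong_AE) auto
  finally have "AE \<theta> in ?M (insert d S). indicator {\<theta>. f \<theta> = 0} \<theta> = (0 :: ennreal)"
    using nn_integral_0_iff_AE[OF ind] by simp
  then show ?case
    by eventually_elim (auto simp: f_def indicator_def split: if_splits)
qed

context hierarchical_model
begin

abbreviation M :: "(('v, 'l) param \<Rightarrow> real) measure" where "M \<equiv> param_space I \<D>"

lemma cell_logit_measurable [measurable]: "(\<lambda>\<theta>. cell_logit \<theta> c) \<in> borel_measurable M"
  unfolding cell_logit_def param_space_def by (intro borel_measurable_sum) auto

lemma Zfun_measurable [measurable]: "Zfun I \<D> \<in> borel_measurable M"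
  unfolding Zfun_eq[abs_def] by measurable

lemma prob_measurable [measurable]: "(\<lambda>\<theta>. prob \<theta> c) \<in> borel_measurable M"
  unfolding prob_def by measurable

lemma jacobian_measurable [measurable]: "jacobian I \<D> \<in> borel_measurable M"
  unfolding jacobian_eq[abs_def] by measurable

lemma prior_kernel_eq:
  "prior_kernel I \<D> s \<alpha> \<theta> = exp ((\<Sum>d\<in>S. \<theta> d * s d) - \<alpha> * ln (Zfun I \<D> \<theta>))"
  using sum_params[of "\<lambda>d. \<theta> d * s d"] by (simp add: prior_kernel_def)

lemma prior_density_measurable [measurable]: "prior_density I \<D> s \<alpha> \<in> borel_measurable M"
proof -
  have [measurable]: "(\<lambda>\<theta>. \<Sum>d\<in>S. \<theta> d * s d) \<in> borel_measurable M"
    unfolding param_space_def by (intro borel_measurable_sum borel_measurable_times) auto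
  show ?thesis
    unfolding prior_density_def[abs_def] prior_kernel_eq by measurable
qed

text \<open>The exponential polynomial is \<open>Z * (1 - \<Sum>\<^sub>c p c * euler H)\<close>. A cell with no face of \<open>\<D>\<close> below it has
  Euler characteristic \<open>0\<close>, hence coefficient \<open>1\<close>, and the cell \<open>i\<^sup>*\<close> is one of them; so the constant
  term is a positive integer.\<close>
lemma AE_jacobian_nonzero: "AE \<theta> in M. jacobian I \<D> \<theta> \<noteq> 0"
proof -
  define T where "T c = {d \<in> S. below d c}" for c
  define w where "w c = 1 - euler (fst c)" for c :: "('v, 'l) param"
  have w: "w c = 1" if "c \<in> cells" "T c = {}" for c
    using sum_below_euler[OF that(1)] that(2) unfolding T_def w_def by (simp only: sum.empty)
  have "({}, \<lambda>_. undefined) \<in> {c \<in> cells. T c = {}}"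
    using empty_notin by (auto simp: T_def below_def params_def star_cells_empty)
  then have "card {c \<in> cells. T c = {}} \<noteq> 0"
    by (auto simp: card_eq_0_iff)
  moreover have "(\<Sum>c\<in>{c \<in> cells. T c = {}}. w c) = card {c \<in> cells. T c = {}}"
    using w by simp
  ultimately have "AE \<theta> in M. (\<Sum>c\<in>cells. w c * exp (\<Sum>d\<in>T c. \<theta> d)) \<noteq> 0"
    unfolding param_space_def by (intro AE_exp_polynomial_nonzero) (auto simp: T_def)
  then show ?thesis
  proof eventually_elim
    fix \<theta> assume nz: "(\<Sum>c\<in>cells. w c * exp (\<Sum>d\<in>T c. \<theta> d)) \<noteq> 0"
    have "1 - (\<Sum>c\<in>cells. prob \<theta> c * euler (fst c)) = (\<Sum>c\<in>cells. w c * prob \<theta> c)"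
      by (simp add: w_def algebra_simps sum_subtractf sum_prob)
    also have "\<dots> = (\<Sum>c\<in>cells. w c * exp (\<Sum>d\<in>T c. \<theta> d)) / Zfun I \<D> \<theta>"
      by (simp add: prob_def cell_logit_def T_def sum_divide_distrib)
    finally have "1 - (\<Sum>c\<in>cells. prob \<theta> c * euler (fst c)) \<noteq> 0"
      using nz Zfun_pos[of \<theta>] by simp
    moreover have "prob \<theta> d \<noteq> 0" for d
      using prob_pos[of \<theta> d] by linarith
    ultimately show "jacobian I \<D> \<theta> \<noteq> 0"
      by (simp add: jacobian_eq)
  qed
qed

section \<open>The induced density\<close>

lemma alpha_cell_eq:
  assumes "c \<in> S"
  shows "alpha_cell I \<D> s (fst c) (snd c) = (\<Sum>d\<in>{d\<in>S. below c d}. (-1) ^ card (fst d - fst c) * s d)"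
proof -
  have "alpha_cell I \<D> s (fst c) (snd c)
      = (\<Sum>(F, j)\<in>(SIGMA F:{F\<in>\<D>. fst c \<subseteq> F}. {j\<in>star_cells I F. restrict j (fst c) = snd c}).
          (-1) ^ card (F - fst c) * s (F, j))"
    unfolding alpha_cell_def by (rule sum.Sigma) auto
  also have "\<dots> = (\<Sum>d\<in>{d\<in>S. below c d}. (-1) ^ card (fst d - fst c) * s d)"
    by (rule sum.cong) (auto simp: params_def below_def)
  finally show ?thesis .
qed

text \<open>Summation by parts: a linear functional with coefficients \<open>\<alpha>(i(D))\<close>, expressed through \<open>s\<close>. The sum
  over all subsets, including the empty one, is isolated so that Moebius inversion can be applied;
  the subtracted term is the contribution of the empty set.\<close>
lemma sum_alpha_cell:
  assumes X: "X ({}, \<lambda>_. undefined) = z"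
  shows "(\<Sum>c\<in>S. alpha_cell I \<D> s (fst c) (snd c) * X c)
    = (\<Sum>d\<in>S. s d * ((\<Sum>D\<in>Pow (fst d). (-1) ^ card (fst d - D) * X (D, restrict (snd d) D))
                     - (-1) ^ card (fst d) * z))"
proof -
  have "(\<Sum>c\<in>S. alpha_cell I \<D> s (fst c) (snd c) * X c)
      = (\<Sum>c\<in>S. \<Sum>d\<in>S. if below c d then (-1) ^ card (fst d - fst c) * s d * X c else 0)"
    by (intro sum.cong refl)
       (auto simp: alpha_cell_eq sum_distrib_right intro!: sum.mono_neutral_cong_left split: if_splits)
  also have "\<dots> = (\<Sum>d\<in>S. \<Sum>c\<in>S. if below c d then (-1) ^ card (fst d - fst c) * s d * X c else 0)"
    by (rule sum.swap)
  also have "\<dots> = (\<Sum>d\<in>S. s d * (\<Sum>c\<in>{c\<in>S. below c d}. (-1) ^ card (fst d - fst c) * X c))"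
    by (intro sum.cong refl)
       (auto simp: sum_distrib_left mult_ac intro!: sum.mono_neutral_cong_right split: if_splits)
  also have "\<dots> = (\<Sum>d\<in>S. s d * ((\<Sum>D\<in>Pow (fst d). (-1) ^ card (fst d - D) * X (D, restrict (snd d) D))
                     - (-1) ^ card (fst d) * z))"
  proof (intro sum.cong refl arg_cong2[where f="(*)"])
    fix d assume "d \<in> S"
    then obtain F j where d: "d = (F, j)" "F \<in> \<D>" "j \<in> star_cells I F"
      by (auto simp: params_def)
    have "{D \<in> \<D>. D \<subseteq> F} = Pow F - {{}}"
      using d(2) down_closed empty_notin by auto
    then have "(\<Sum>c\<in>{c\<in>S. below c d}. (-1) ^ card (fst d - fst c) * X c)
        = (\<Sum>D\<in>Pow F - {{}}. (-1) ^ card (F - D) * X (D, restrict j D))"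
      unfolding d(1) using sum_params_below[OF d(3), where \<D>=\<D>
          and f="\<lambda>c. (-1) ^ card (F - fst c) * X c"] by simp
    also have "\<dots> = (\<Sum>D\<in>Pow F. (-1) ^ card (F - D) * X (D, restrict j D)) - (-1) ^ card F * z"
      using X by (subst sum.remove[of "Pow F" "{}"]) (auto simp: restrict_def)
    finally show "(\<Sum>c\<in>{c\<in>S. below c d}. (-1) ^ card (fst d - fst c) * X c)
        = (\<Sum>D\<in>Pow (fst d). (-1) ^ card (fst d - D) * X (D, restrict (snd d) D)) - (-1) ^ card (fst d) * z"
      by (simp add: d)
  qed
  finally show ?thesis .
qed

text \<open>Since \<open>cell_logit \<theta>\<close> is the sum of \<open>\<theta>\<close> over a lower set, Moebius inversion returns \<open>\<theta>\<close>.\<close>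
lemma sum_alpha_cell_logit:
  "(\<Sum>c\<in>S. alpha_cell I \<D> s (fst c) (snd c) * cell_logit \<theta> c) = (\<Sum>d\<in>S. \<theta> d * s d)"
proof -
  have "(\<Sum>D\<in>Pow (fst d). (-1) ^ card (fst d - D) * cell_logit \<theta> (D, restrict (snd d) D)) = \<theta> d" if "d \<in> S" for d
  proof -
    obtain F j where d: "d = (F, j)" "F \<in> \<D>" "j \<in> star_cells I F"
      using \<open>d \<in> S\<close> by (auto simp: params_def)
    have cell_logit: "cell_logit \<theta> (D, restrict j D) = (\<Sum>E\<in>Pow D. if E = {} then 0 else \<theta> (E, restrict j E))" if "D \<subseteq> F" for D
    proof -
      have "E \<in> \<D>" if "E \<subseteq> D" "E \<noteq> {}" for E
        using down_closed[OF d(2)] that \<open>D \<subseteq> F\<close> by (meson order_trans)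
      then have "{E \<in> \<D>. E \<subseteq> D} = Pow D - {{}}"
        using empty_notin by auto
      then have "cell_logit \<theta> (D, restrict j D) = (\<Sum>E\<in>Pow D - {{}}. \<theta> (E, restrict (restrict j D) E))"
        unfolding cell_logit_def using sum_params_below[OF restrict_star_cells[OF d(3) that], where \<D>=\<D> and f=\<theta>]
        by simp
      also have "\<dots> = (\<Sum>E\<in>Pow D. if E = {} then 0 else \<theta> (E, restrict j E))"
        by (rule sum.mono_neutral_cong_left) (auto simp: Int_absorb1)
      finally show ?thesis .
    qed
    have "(\<Sum>D\<in>Pow F. (-1) ^ card (F - D) * cell_logit \<theta> (D, restrict j D))
        = (\<Sum>D\<in>Pow F. (-1) ^ card (F - D) * (\<Sum>E\<in>Pow D. if E = {} then 0 else \<theta> (E, restrict j E)))"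
      by (intro sum.cong) (auto simp: cell_logit)
    also have "\<dots> = (if F = {} then 0 else \<theta> (F, restrict j F))"
      by (rule moebius_subsets)
    also have "\<dots> = \<theta> d"
      using d empty_notin by (auto simp: star_cells_def PiE_restrict)
    finally show ?thesis
      by (simp add: d)
  qed
  then show ?thesis
    by (subst sum_alpha_cell[where X="cell_logit \<theta>" and z=0, OF cell_logit_empty]) (simp add: mult.commute)
qed

text \<open>The exponents add up to \<open>\<alpha>\<close>, which accounts for the power of \<open>Z\<close>: for a nonempty support the
  alternating sum over all subsets is \<open>0\<close>, and what remains cancels the correction in \<open>\<alpha>\<^sub>\<emptyset>\<close>.\<close>
lemma sum_alpha:
  "(\<Sum>c\<in>S. alpha_cell I \<D> s (fst c) (snd c)) + alpha_empty I \<D> s \<alpha> = \<alpha>"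
proof -
  have "(\<Sum>D\<in>Pow F. (-1) ^ card (F - D)) = (0 :: real)" if "F \<noteq> {}" for F :: "'v set"
  proof -
    have "(\<Sum>E\<in>Pow D. of_bool (E = {})) = (1 :: real)" for D :: "'v set"
      by (subst sum.remove[of _ "{}"]) auto
    then show ?thesis
      using moebius_subsets[where f="\<lambda>E. of_bool (E = {})" and F=F] that by simp
  qed
  moreover have "fst d \<noteq> {}" if "d \<in> S" for d
    using that empty_notin by (auto simp: params_def)
  ultimately have "(\<Sum>D\<in>Pow (fst d). (-1) ^ card (fst d - D)) = (0 :: real)" if "d \<in> S" for d
    using that by blast
  then have "(\<Sum>c\<in>S. alpha_cell I \<D> s (fst c) (snd c)) = (\<Sum>d\<in>S. - ((-1) ^ card (fst d) * s d))"
    using sum_alpha_cell[of "\<lambda>_. 1" 1 s] by (simp add: mult.commute)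
  moreover have "alpha_empty I \<D> s \<alpha> = \<alpha> + (\<Sum>d\<in>S. (-1) ^ card (fst d) * s d)"
    using sum_params[of "\<lambda>d. (-1) ^ card (fst d) * s d"] by (simp add: alpha_empty_def)
  ultimately show ?thesis
    by (simp add: sum_negf)
qed

text \<open>The factor \<open>K\<close> contributes \<open>p\<^sub>\<emptyset> * (\<Prod>p)\<close>, which raises every exponent by one. At critical points
  both sides are \<open>0\<close>.\<close>
lemma induced_density_eq:
  "induced_density I \<D> s \<alpha> \<theta> = prior_density I \<D> s \<alpha> \<theta> / \<bar>jacobian I \<D> \<theta>\<bar>"
proof -
  let ?p0 = "prob_empty I \<D> \<theta>" and ?a0 = "alpha_empty I \<D> s \<alpha>"
  define a where "a c = alpha_cell I \<D> s (fst c) (snd c)" for c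
  have p0: "?p0 = inverse (Zfun I \<D> \<theta>)" "?p0 > 0"
    using Zfun_pos[of \<theta>] by (simp_all add: prob_empty_def)
  have powr: "(\<Prod>D\<in>\<D>. \<Prod>i\<in>star_cells I D. cell_prob I \<D> \<theta> D i powr (alpha_cell I \<D> s D i - 1))
      = (\<Prod>c\<in>S. prob \<theta> c powr (a c - 1))"
    by (simp add: cell_prob_eq a_def flip: prod_params)
  have "(\<Prod>c\<in>S. prob \<theta> c) * (\<Prod>c\<in>S. prob \<theta> c powr (a c - 1)) = (\<Prod>c\<in>S. exp (a c * (cell_logit \<theta> c - ln (Zfun I \<D> \<theta>))))"
    unfolding prod.distrib[symmetric]
  proof (intro prod.cong refl)
    fix c
    have "prob \<theta> c * prob \<theta> c powr (a c - 1) = prob \<theta> c powr (a c)"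
      using prob_pos[of \<theta> c] by (simp add: powr_mult_base)
    also have "\<dots> = exp (a c * ln (prob \<theta> c))"
      using prob_pos[of \<theta> c] by (simp add: powr_def)
    also have "ln (prob \<theta> c) = cell_logit \<theta> c - ln (Zfun I \<D> \<theta>)"
      using Zfun_pos[of \<theta>] by (simp add: prob_def ln_div)
    finally show "prob \<theta> c * prob \<theta> c powr (a c - 1) = exp (a c * (cell_logit \<theta> c - ln (Zfun I \<D> \<theta>)))" .
  qed
  also have "\<dots> = exp ((\<Sum>c\<in>S. a c * cell_logit \<theta> c) - (\<Sum>c\<in>S. a c) * ln (Zfun I \<D> \<theta>))"
    by (simp add: exp_sum[symmetric] right_diff_distrib sum_subtractf sum_distrib_right)
  finally have 1: "(\<Prod>c\<in>S. prob \<theta> c) * (\<Prod>c\<in>S. prob \<theta> c powr (a c - 1))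
      = exp ((\<Sum>d\<in>S. \<theta> d * s d) - (\<Sum>c\<in>S. a c) * ln (Zfun I \<D> \<theta>))"
    by (simp add: a_def sum_alpha_cell_logit)
  have "?p0 * ?p0 powr (?a0 - 1) = ?p0 powr ?a0"
    using p0(2) by (simp add: powr_mult_base)
  also have "\<dots> = exp (- ?a0 * ln (Zfun I \<D> \<theta>))"
    using p0 Zfun_pos[of \<theta>] by (simp add: powr_def ln_inverse)
  finally have 2: "?p0 * ?p0 powr (?a0 - 1) = exp (- ?a0 * ln (Zfun I \<D> \<theta>))" .
  have "(\<Sum>d\<in>S. \<theta> d * s d) - (\<Sum>c\<in>S. a c) * ln (Zfun I \<D> \<theta>) + - ?a0 * ln (Zfun I \<D> \<theta>)
      = (\<Sum>d\<in>S. \<theta> d * s d) - ((\<Sum>c\<in>S. a c) + ?a0) * ln (Zfun I \<D> \<theta>)"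
    by (simp add: algebra_simps)
  also have "(\<Sum>c\<in>S. a c) + ?a0 = \<alpha>"
    unfolding a_def by (rule sum_alpha)
  finally have "(\<Prod>c\<in>S. prob \<theta> c) * (\<Prod>c\<in>S. prob \<theta> c powr (a c - 1)) * (?p0 * ?p0 powr (?a0 - 1))
      = prior_kernel I \<D> s \<alpha> \<theta>"
    unfolding 1 2 prior_kernel_eq by (simp flip: exp_add)
  then show ?thesis
    unfolding induced_density_def prior_density_def Kfun_def prod_cell_prob powr
    by (simp add: field_simps)
qed

lemma prior_density_nonneg: "prior_density I \<D> s \<alpha> \<theta> \<ge> 0"
proof -
  have "prior_const I \<D> s \<alpha> \<ge> 0"
    unfolding prior_const_def by (intro Bochner_Integration.integral_nonneg) (simp add: prior_kernel_def)
  then show ?thesis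
    by (simp add: prior_density_def prior_kernel_def)
qed

lemma cell_logit_restrict: "cell_logit (restrict \<theta> S) = cell_logit \<theta>"
  unfolding cell_logit_def by (intro ext sum.cong) auto

lemma prob_restrict: "prob (restrict \<theta> S) = prob \<theta>"
  by (simp add: prob_def Zfun_eq cell_logit_restrict fun_eq_iff)

lemma cell_logit_has_derivative:
  "((\<lambda>x :: real^('v, 'l) param. cell_logit (($) x) c) has_derivative (\<lambda>v. cell_logit (($) v) c)) (at x)"
  unfolding cell_logit_def
  by (intro has_derivative_sum bounded_linear_imp_has_derivative bounded_linear_vec_nth)

text \<open>The total derivative of a cell probability is \<open>p c\<close> times the derivative of its logit, centred by
  the mean over all cells.\<close>
lemma sum_jac_matrix:
  assumes "c \<in> S"
  shows "(\<Sum>d\<in>S. jac_matrix \<theta> c d * v d) = prob \<theta> c * (cell_logit v c - (\<Sum>e\<in>cells. prob \<theta> e * cell_logit v e))"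
proof -
  have cell_logit: "(\<Sum>d\<in>S. if below d e then v d else 0) = cell_logit v e" for e
    unfolding cell_logit_def by (rule sum.mono_neutral_cong_right) auto
  have "(\<Sum>d\<in>S. marginal \<theta> d * v d) = (\<Sum>d\<in>S. \<Sum>e\<in>cells. prob \<theta> e * (if below d e then v d else 0))"
    unfolding marginal_def sum_distrib_right
    by (intro sum.cong refl sum.mono_neutral_cong_left) auto
  also have "\<dots> = (\<Sum>e\<in>cells. prob \<theta> e * cell_logit v e)"
    by (subst sum.swap) (simp add: cell_logit flip: sum_distrib_left)
  finally have m: "(\<Sum>d\<in>S. marginal \<theta> d * v d) = (\<Sum>e\<in>cells. prob \<theta> e * cell_logit v e)" .
  have "(\<Sum>d\<in>S. jac_matrix \<theta> c d * v d) = (\<Sum>d\<in>S. prob \<theta> c * ((if below d c then v d else 0) - marginal \<theta> d * v d))"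
    using assms by (intro sum.cong) (auto simp: jac_matrix_def algebra_simps)
  also have "\<dots> = prob \<theta> c * (cell_logit v c - (\<Sum>e\<in>cells. prob \<theta> e * cell_logit v e))"
    by (simp add: sum_subtractf cell_logit m flip: sum_distrib_left)
  finally show ?thesis .
qed

lemma prob_has_derivative:
  assumes "c \<in> S"
  shows "((\<lambda>x :: real^('v, 'l) param. prob (($) x) c) has_derivative
           (\<lambda>v. \<Sum>d\<in>S. jac_matrix (($) x) c d * v $ d)) (at x)"
proof -
  let ?Z = "\<Sum>c\<in>cells. exp (cell_logit (($) x) c)"
  have Z: "?Z \<noteq> 0"
    using Zfun_pos[of "($) x"] by (simp add: Zfun_eq)
  have e: "((\<lambda>x. exp (cell_logit (($) x) c)) has_derivative (\<lambda>v. exp (cell_logit (($) x) c) * cell_logit (($) v) c)) (at x)" for c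
    using has_derivative_exp[OF cell_logit_has_derivative, of c x] by (simp add: mult.commute)
  have "((\<lambda>x. exp (cell_logit (($) x) c) / (\<Sum>c\<in>cells. exp (cell_logit (($) x) c))) has_derivative
      (\<lambda>v. (exp (cell_logit (($) x) c) * cell_logit (($) v) c * ?Z
        - exp (cell_logit (($) x) c) * (\<Sum>e\<in>cells. exp (cell_logit (($) x) e) * cell_logit (($) v) e)) / (?Z * ?Z))) (at x)"
    by (rule has_derivative_divide'[OF e has_derivative_sum[OF e] Z])
  moreover have "(exp (cell_logit (($) x) c) * cell_logit (($) v) c * ?Z
        - exp (cell_logit (($) x) c) * (\<Sum>e\<in>cells. exp (cell_logit (($) x) e) * cell_logit (($) v) e)) / (?Z * ?Z)
      = (\<Sum>d\<in>S. jac_matrix (($) x) c d * v $ d)" for v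
  proof -
    have "(\<Sum>d\<in>S. jac_matrix (($) x) c d * v $ d)
        = exp (cell_logit (($) x) c) / ?Z * (cell_logit (($) v) c - (\<Sum>e\<in>cells. exp (cell_logit (($) x) e) * cell_logit (($) v) e) / ?Z)"
      unfolding sum_jac_matrix[OF assms] by (simp add: prob_def Zfun_eq sum_divide_distrib)
    then show ?thesis
      using Z by (simp add: field_simps)
  qed
  ultimately show ?thesis
    by (simp add: prob_def Zfun_eq)
qed

lemma jac_matrix_continuous: "continuous_on UNIV (\<lambda>x :: real^('v, 'l) param. jac_matrix (($) x) c d)"
proof -
  have cell_logit: "continuous_on UNIV (\<lambda>x :: real^('v, 'l) param. cell_logit (($) x) e)" for e
    unfolding cell_logit_def by (intro continuous_intros)
  have prob: "continuous_on UNIV (\<lambda>x :: real^('v, 'l) param. prob (($) x) e)" for e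
    unfolding prob_def using Zfun_pos by (intro continuous_intros cell_logit) (auto simp: Zfun_eq intro!: continuous_intros cell_logit less_imp_neq[symmetric])
  show ?thesis
    unfolding jac_matrix_def marginal_def by (cases "c \<in> S") (auto intro!: continuous_intros prob)
qed

text \<open>The set \<open>U\<close> covers both uses of the area formula: a region of injectivity, where the fibre sum has
  a single nonzero term, and the whole space.\<close>
lemma distr_prob_param:
  assumes U: "U \<in> sets M"
  shows "distr (density M (\<lambda>\<theta>. ennreal (indicator U \<theta> * prior_density I \<D> s \<alpha> \<theta>))) M (prob_param I \<D>)
    = density M (\<lambda>p. \<Sum>\<^sub>\<infinity>\<theta>\<in>{\<theta>\<in>space M. prob_param I \<D> \<theta> = p}.
        ennreal (indicator U \<theta> * induced_density I \<D> s \<alpha> \<theta>))"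
proof -
  note [measurable] = U
  let ?h = "\<lambda>\<theta>. ennreal (indicator U \<theta> * induced_density I \<D> s \<alpha> \<theta>)"
  have hm [measurable]: "?h \<in> borel_measurable M"
    unfolding induced_density_eq by measurable
  have "density M (\<lambda>\<theta>. ennreal (indicator U \<theta> * prior_density I \<D> s \<alpha> \<theta>))
      = density M (\<lambda>\<theta>. ?h \<theta> * ennreal \<bar>det_on S (jac_matrix \<theta>)\<bar>)"
  proof (rule density_cong)
    show "AE \<theta> in M. ennreal (indicator U \<theta> * prior_density I \<D> s \<alpha> \<theta>) = ?h \<theta> * ennreal \<bar>det_on S (jac_matrix \<theta>)\<bar>"
      using AE_jacobian_nonzero
    proof eventually_elim
      fix \<theta> assume "jacobian I \<D> \<theta> \<noteq> 0"
      then have eq: "indicator U \<theta> * prior_density I \<D> s \<alpha> \<theta>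
          = indicator U \<theta> * induced_density I \<D> s \<alpha> \<theta> * \<bar>det_on S (jac_matrix \<theta>)\<bar>"
        by (simp add: induced_density_eq flip: jacobian_eq_det_on)
      show "ennreal (indicator U \<theta> * prior_density I \<D> s \<alpha> \<theta>) = ?h \<theta> * ennreal \<bar>det_on S (jac_matrix \<theta>)\<bar>"
        unfolding eq using prior_density_nonneg[of s \<alpha> \<theta>]
        by (intro ennreal_mult) (simp_all add: induced_density_eq)
    qed
  qed (simp_all flip: jacobian_eq_det_on)
  moreover have "distr (density M (\<lambda>\<theta>. ?h \<theta> * ennreal \<bar>det_on S (jac_matrix \<theta>)\<bar>)) M (prob_param I \<D>)
    = density M (\<lambda>p. \<Sum>\<^sub>\<infinity>\<theta>\<in>{\<theta>\<in>space M. prob_param I \<D> \<theta> = p}. ?h \<theta>)"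
    unfolding param_space_def
  proof (rule area_formula_PiM(2))
    show "prob_param I \<D> (restrict \<theta> S) = prob_param I \<D> \<theta>" for \<theta>
      by (simp add: prob_param_eq prob_restrict)
    show "jac_matrix (restrict \<theta> S) c d = jac_matrix \<theta> c d" for \<theta> c d
      by (simp add: jac_matrix_def marginal_def prob_restrict)
    show "((\<lambda>x. prob_param I \<D> (($) x) c) has_derivative (\<lambda>v. \<Sum>d\<in>S. jac_matrix (($) x) c d * v $ d)) (at x)"
      if "c \<in> S" for c and x :: "real^('v, 'l) param"
      using prob_has_derivative[OF that, of x] that by (simp add: prob_param_eq)
    show "?h \<theta> = 0" if "det_on S (jac_matrix \<theta>) = 0" for \<theta>
      using that by (simp add: induced_density_eq jacobian_eq_det_on)
  qed (use hm in \<open>auto simp: prob_param_eq jac_matrix_continuous param_space_def\<close>)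
  ultimately show ?thesis
    by simp
qed

end

lemma infsum_single:
  fixes f :: "'a \<Rightarrow> 'b::{comm_monoid_add, t2_space}"
  assumes "x \<in> A" "\<And>y. y \<in> A \<Longrightarrow> y \<noteq> x \<Longrightarrow> f y = 0"
  shows "(\<Sum>\<^sub>\<infinity>y\<in>A. f y) = f x"
proof -
  have "(\<Sum>\<^sub>\<infinity>y\<in>A. f y) = (\<Sum>\<^sub>\<infinity>y\<in>{x}. f y)"
    using assms by (intro infsum_cong_neutral) auto
  then show ?thesis by simp
qed

theorem theorem4p1:
  fixes I :: "'v::finite \<Rightarrow> 'l::{finite,zero} set"
    and A :: "'v set set"
    and \<D> :: "'v set set"
    and s :: "('v, 'l) param \<Rightarrow> real"
    and \<alpha> :: real
  assumes levels: "\<And>v. 0 \<in> I v" "\<And>v. 2 \<le> card (I v)"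
    and model: "\<D> = interaction_sets A"
    and proper: "proper_prior I \<D> s \<alpha>"
  shows
    "(\<forall>\<theta>\<in>space (param_space I \<D>). jacobian I \<D> \<theta> =
       (\<Prod>D\<in>\<D>. \<Prod>i\<in>star_cells I D. cell_prob I \<D> \<theta> D i) *
       (1 - (\<Sum>H\<in>{H. H \<noteq> {}}. \<Sum>l\<in>star_cells I H. cell_prob I \<D> \<theta> H l *
               (\<Sum>F\<in>{F\<in>\<D>. F \<subseteq> H}. (-1) ^ (card F - 1)))))
     \<and> (\<forall>G. sym G \<and> irrefl G \<and> A = cliques G \<longrightarrow>
       (\<forall>\<theta>\<in>space (param_space I \<D>). jacobian I \<D> \<theta> =
         (\<Prod>D\<in>\<D>. \<Prod>i\<in>star_cells I D. cell_prob I \<D> \<theta> D i) *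
         (prob_empty I \<D> \<theta> -
           (\<Sum>H\<in>U_ominus G. \<Sum>i\<in>star_cells I H. cell_prob I \<D> \<theta> H i * a_coeff \<D> H))))
     \<and> (\<forall>U\<in>sets (param_space I \<D>). inj_on (prob_param I \<D>) U \<longrightarrow>
       distr (density (param_space I \<D>)
                (\<lambda>\<theta>. ennreal (indicator U \<theta> * prior_density I \<D> s \<alpha> \<theta>)))
             (param_space I \<D>) (prob_param I \<D>) =
       density (param_space I \<D>)
         (\<lambda>p. ennreal (indicator (prob_param I \<D> ` U) p *
                induced_density I \<D> s \<alpha> (inv_into U (prob_param I \<D>) p))))
     \<and> distr (density (param_space I \<D>) (\<lambda>\<theta>. ennreal (prior_density I \<D> s \<alpha> \<theta>)))
           (param_space I \<D>) (prob_param I \<D>) =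
         density (param_space I \<D>)
           (\<lambda>p. \<Sum>\<^sub>\<infinity>\<theta>\<in>{\<theta>\<in>space (param_space I \<D>). prob_param I \<D> \<theta> = p}.
                  ennreal (induced_density I \<D> s \<alpha> \<theta>))"
proof -
  interpret hierarchical_model I \<D>
    by (unfold_locales; unfold model interaction_sets_def; blast)
  show ?thesis
  proof (intro conjI ballI allI impI)
    show "jacobian I \<D> \<theta> =
       (\<Prod>D\<in>\<D>. \<Prod>i\<in>star_cells I D. cell_prob I \<D> \<theta> D i) *
       (1 - (\<Sum>H\<in>{H. H \<noteq> {}}. \<Sum>l\<in>star_cells I H. cell_prob I \<D> \<theta> H l *
               (\<Sum>F\<in>{F\<in>\<D>. F \<subseteq> H}. (-1) ^ (card F - 1))))" for \<theta>
      by (rule jacobian_general)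
  next
    fix G and \<theta> :: "('v, 'l) param \<Rightarrow> real"
    assume G: "sym G \<and> irrefl G \<and> A = cliques G"
    then have \<D>: "\<D> = {F. complete_set G F \<and> F \<noteq> {}}"
      by (simp add: model interaction_sets_cliques)
    have "euler H = clique_euler G H" for H
      unfolding euler_def clique_euler_def by (simp add: \<D> conj_assoc)
    then show "jacobian I \<D> \<theta> =
         (\<Prod>D\<in>\<D>. \<Prod>i\<in>star_cells I D. cell_prob I \<D> \<theta> D i) *
         (prob_empty I \<D> \<theta> -
           (\<Sum>H\<in>U_ominus G. \<Sum>i\<in>star_cells I H. cell_prob I \<D> \<theta> H i * a_coeff \<D> H))"
      using G by (intro jacobian_graphical) (auto simp: U_ominus_def clique_euler_chordal_connected)
  next
    fix U assume U: "U \<in> sets M" and inj: "inj_on (prob_param I \<D>) U"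
    have "(\<Sum>\<^sub>\<infinity>\<theta>\<in>{\<theta>\<in>space M. prob_param I \<D> \<theta> = p}. ennreal (indicator U \<theta> * induced_density I \<D> s \<alpha> \<theta>))
        = ennreal (indicator (prob_param I \<D> ` U) p *
                induced_density I \<D> s \<alpha> (inv_into U (prob_param I \<D>) p))" for p
    proof (cases "p \<in> prob_param I \<D> ` U")
      case True
      then obtain \<theta> where \<theta>: "\<theta> \<in> U" "prob_param I \<D> \<theta> = p"
        by blast
      then have inv: "inv_into U (prob_param I \<D>) p = \<theta>"
        using inj by (metis inv_into_f_f)
      have "\<theta>' \<notin> U" if "prob_param I \<D> \<theta>' = p" "\<theta>' \<noteq> \<theta>" for \<theta>'
        using that \<theta> inj by (auto dest: inj_onD)
      moreover have "\<theta> \<in> space M"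
        using \<theta>(1) U sets.sets_into_space by blast
      ultimately show ?thesis
        using True \<theta> by (subst infsum_single[of \<theta>]) (auto simp: inv)
    next
      case False
      then have "\<theta> \<notin> U" if "prob_param I \<D> \<theta> = p" for \<theta>
        using that by blast
      with False show ?thesis
        by (subst infsum_0) auto
    qed
    then show "distr (density M (\<lambda>\<theta>. ennreal (indicator U \<theta> * prior_density I \<D> s \<alpha> \<theta>))) M (prob_param I \<D>) =
       density M (\<lambda>p. ennreal (indicator (prob_param I \<D> ` U) p *
                induced_density I \<D> s \<alpha> (inv_into U (prob_param I \<D>) p)))"
      by (simp add: distr_prob_param[OF U])
  next
    let ?U = "space M"
    have "distr (density M (\<lambda>\<theta>. ennreal (prior_density I \<D> s \<alpha> \<theta>))) M (prob_param I \<D>)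
        = distr (density M (\<lambda>\<theta>. ennreal (indicator ?U \<theta> * prior_density I \<D> s \<alpha> \<theta>))) M (prob_param I \<D>)"
      by (intro arg_cong[where f="\<lambda>N. distr N M (prob_param I \<D>)"] density_cong) auto
    also have "\<dots> = density M (\<lambda>p. \<Sum>\<^sub>\<infinity>\<theta>\<in>{\<theta>\<in>?U. prob_param I \<D> \<theta> = p}.
        ennreal (indicator ?U \<theta> * induced_density I \<D> s \<alpha> \<theta>))"
      by (rule distr_prob_param) simp
    also have "\<dots> = density M (\<lambda>p. \<Sum>\<^sub>\<infinity>\<theta>\<in>{\<theta>\<in>?U. prob_param I \<D> \<theta> = p}.
        ennreal (induced_density I \<D> s \<alpha> \<theta>))"
      by (intro arg_cong[where f="density M"] ext infsum_cong) auto
    finally show "distr (density M (\<lambda>\<theta>. ennreal (prior_density I \<D> s \<alpha> \<theta>))) M (prob_param I \<D>)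
        = density M (\<lambda>p. \<Sum>\<^sub>\<infinity>\<theta>\<in>{\<theta>\<in>?U. prob_param I \<D> \<theta> = p}. ennreal (induced_density I \<D> s \<alpha> \<theta>))" .
  qed
qed

end
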